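(* There exists a universal constant $C>0$ such that for every $d,m\in\mathbb{N}$ and every finite reflection group $G\leq\operatorname{O}(d)$ of order $m$, the optimal max filtering condition number of $G$ satisfies $\kappa(G)\leq Cm$.
   Context: For nonzero $u\in\mathbb{R}^d$, let $R(u)=I-\frac{2}{\|u\|^2}uu^\top$; such maps are called reflections. A reflection group is a subgroup of $\operatorname{O}(d)$ generated by reflections. For a finite group $G\leq\operatorname{O}(d)$, $\mathbb{R}^d/G$ is the set of orbits $G\cdot x$ with metric $d(G\cdot x,G\cdot y)=\min_{p\in G\cdot x,\,q\in G\cdot y}\|p-q\|$. Put $\langle\!\langle G\cdot x,G\cdot y\rangle\!\rangle=\max_{p\in G\cdot x,\,q\in G\cdot y}\langle p,q\rangle$. Given templates $t_1,\dots,t_n\in\mathbb{R}^d$, the max filter bank is $\Phi\colon\mathbb{R}^d/G\to\mathbb{R}^n$, $\Phi(G\cdot x)=\{\langle\!\langle G\cdot t_i,G\cdot x\rangle\!\rangle\}_{i=1}^n$. The optimal max filtering condition number $\kappa(G)$ is the infimum of quotients $C'/c'$ over all $n\in\mathbb{N}$, templates $t_1,\dots,t_n\in\mathbb{R}^d$, and constants $C',c'>0$ such that $c'\,d(G\cdot x,G\cdot y)\le\|\Phi(G\cdot x)-\Phi(G\cdot y)\|\le C'\,d(G\cdot x,G\cdot y)$ for all $x,y\in\mathbb{R}^d$. *)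

theory Defs
  imports
    "Jordan_Normal_Form.Determinant"
    "HOL-Algebra.Generated_Groups"
    "HOL-Library.Extended_Real"
begin

text \<open>
  The constant of the theorem is independent of the dimension, so the dimension has to be
  quantified inside the formula. Hence \<open>\<real>\<^sup>d\<close> is \<^term>\<open>carrier_vec d :: real vec set\<close>, and linear
  maps on it are matrices in \<^term>\<open>carrier_mat d d :: real mat set\<close>.
\<close>

definition vec_norm :: "real vec \<Rightarrow> real" where
  "vec_norm v = sqrt (scalar_prod v v)"

text \<open>The predicate \<^const>\<open>orthogonal_mat\<close> of the library does not require unit columns and
  is therefore not used here.\<close>

definition orthogonal_group :: "nat \<Rightarrow> real mat monoid" where
  "orthogonal_group d =
     \<lparr>carrier = {A \<in> carrier_mat d d. transpose_mat A * A = 1\<^sub>m d},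
      monoid.mult = (*), one = 1\<^sub>m d\<rparr>"

definition reflection :: "real vec \<Rightarrow> real mat" where
  "reflection u =
     (let d = dim_vec u; U = mat_of_cols d [u]
      in 1\<^sub>m d - (2 / (vec_norm u)\<^sup>2) \<cdot>\<^sub>m (U * transpose_mat U))"

definition reflections :: "nat \<Rightarrow> real mat set" where
  "reflections d = {reflection u | u. u \<in> carrier_vec d \<and> u \<noteq> 0\<^sub>v d}"

definition reflection_group :: "nat \<Rightarrow> real mat set \<Rightarrow> bool" where
  "reflection_group d G \<longleftrightarrow>
     subgroup G (orthogonal_group d) \<and>
     (\<exists>S \<subseteq> reflections d. G = generate (orthogonal_group d) S)"

definition orbit_of :: "real mat set \<Rightarrow> real vec \<Rightarrow> real vec set" where
  "orbit_of G x = {g *\<^sub>v x | g. g \<in> G}"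

text \<open>\<^const>\<open>Min\<close> and \<^const>\<open>Max\<close> are meaningful because orbits of a finite group are finite
  and nonempty.\<close>

definition orbit_dist :: "real vec set \<Rightarrow> real vec set \<Rightarrow> real" where
  "orbit_dist X Y = Min {vec_norm (p - q) | p q. p \<in> X \<and> q \<in> Y}"

definition max_filter :: "real vec set \<Rightarrow> real vec set \<Rightarrow> real" where
  "max_filter X Y = Max {scalar_prod p q | p q. p \<in> X \<and> q \<in> Y}"

definition max_filter_bank :: "real mat set \<Rightarrow> real vec list \<Rightarrow> real vec set \<Rightarrow> real vec" where
  "max_filter_bank G ts X = vec (length ts) (\<lambda>i. max_filter (orbit_of G (ts ! i)) X)"

definition bilipschitz_bank ::
  "nat \<Rightarrow> real mat set \<Rightarrow> real vec list \<Rightarrow> real \<Rightarrow> real \<Rightarrow> bool" where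
  "bilipschitz_bank d G ts c' C' \<longleftrightarrow>
     (\<forall>x \<in> carrier_vec d. \<forall>y \<in> carrier_vec d.
        (let X = orbit_of G x; Y = orbit_of G y;
             D = vec_norm (max_filter_bank G ts X - max_filter_bank G ts Y)
         in c' * orbit_dist X Y \<le> D \<and> D \<le> C' * orbit_dist X Y))"

text \<open>The infimum is taken in \<^typ>\<open>ereal\<close>, so that it would be \<open>\<infinity>\<close> if no max filter bank were
  bilipschitz.\<close>

definition max_filter_cond :: "nat \<Rightarrow> real mat set \<Rightarrow> ereal" where
  "max_filter_cond d G =
     Inf {ereal (C' / c') | ts C' c'.
            set ts \<subseteq> carrier_vec d \<and> 0 < c' \<and> 0 < C' \<and> bilipschitz_bank d G ts c' C'}"

lemma group_orthogonal_group: "group (orthogonal_group d)"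
proof (rule groupI)
  fix A B assume "A \<in> carrier (orthogonal_group d)" "B \<in> carrier (orthogonal_group d)"
  then have A: "A \<in> carrier_mat d d" "transpose_mat A * A = 1\<^sub>m d"
    and B: "B \<in> carrier_mat d d" "transpose_mat B * B = 1\<^sub>m d"
    by (auto simp: orthogonal_group_def)
  have "transpose_mat (A * B) * (A * B) = transpose_mat B * ((transpose_mat A * A) * B)"
    using A(1) B(1) by (simp add: transpose_mult[of _ d d _ d] assoc_mult_mat[of _ d d _ d _ d])
  then show "A \<otimes>\<^bsub>orthogonal_group d\<^esub> B \<in> carrier (orthogonal_group d)"
    using A B by (simp add: orthogonal_group_def)
next
  fix A assume "A \<in> carrier (orthogonal_group d)"
  then have A: "A \<in> carrier_mat d d" "transpose_mat A * A = 1\<^sub>m d"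
    by (auto simp: orthogonal_group_def)
  then have "A * transpose_mat A = 1\<^sub>m d"
    using mat_mult_left_right_inverse[of "transpose_mat A" d A] by simp
  then show "\<exists>B \<in> carrier (orthogonal_group d). B \<otimes>\<^bsub>orthogonal_group d\<^esub> A = \<one>\<^bsub>orthogonal_group d\<^esub>"
    using A by (intro bexI[of _ "transpose_mat A"]) (simp_all add: orthogonal_group_def)
qed (auto simp: orthogonal_group_def)

lemma reflection_eq:
  assumes "u \<in> carrier_vec d"
  shows "reflection u =
    mat d d (\<lambda>(i, j). (if i = j then 1 else 0) - 2 / scalar_prod u u * (u $ i * u $ j))"
proof -
  have "scalar_prod u u \<ge> 0"
    by (simp add: scalar_prod_def sum_nonneg)
  then show ?thesis
    using assms
    by (intro eq_matI)
      (auto simp: reflection_def vec_norm_def Let_def mat_of_cols_def scalar_prod_def)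
qed

lemma reflections_orthogonal: "reflections d \<subseteq> carrier (orthogonal_group d)"
proof
  fix A assume "A \<in> reflections d"
  then obtain u where u: "u \<in> carrier_vec d" "u \<noteq> 0\<^sub>v d" and A: "A = reflection u"
    by (auto simp: reflections_def)
  define s where "s = scalar_prod u u"
  define c where "c = 2 / s"
  have s: "s = (\<Sum>k = 0..<d. u $ k * u $ k)"
    using u(1) by (auto simp: s_def scalar_prod_def)
  have "s \<noteq> 0"
  proof
    assume "s = 0"
    then have "\<forall>k \<in> {0..<d}. u $ k * u $ k = 0"
      unfolding s by (subst (asm) sum_nonneg_eq_0_iff) auto
    then have "u = 0\<^sub>v d"
      using u(1) by (intro eq_vecI) auto
    with u(2) show False by simp
  qed
  then have cs: "c * c * s = 2 * c"
    by (simp add: c_def field_simps)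
  have A_eq: "A = mat d d (\<lambda>(i, j). (if i = j then 1 else 0) - c * (u $ i * u $ j))"
    unfolding A c_def s_def by (rule reflection_eq[OF u(1)])
  have "transpose_mat A * A = 1\<^sub>m d"
  proof (intro eq_matI)
    fix i j assume "i < dim_row (1\<^sub>m d :: real mat)" "j < dim_col (1\<^sub>m d :: real mat)"
    then have ij: "i < d" "j < d" by auto
    let ?e = "\<lambda>k l :: nat. if k = l then 1 else 0 :: real"
    have "(transpose_mat A * A) $$ (i, j) =
        (\<Sum>k = 0..<d. (?e k i - c * (u $ k * u $ i)) * (?e k j - c * (u $ k * u $ j)))"
      using ij by (simp add: A_eq scalar_prod_def)
    also have "\<dots> = (\<Sum>k = 0..<d. (if k = i then ?e k j else 0)
        - (if k = i then c * (u $ k * u $ j) else 0) - (if k = j then c * (u $ k * u $ i) else 0)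
        + c * c * (u $ i * u $ j) * (u $ k * u $ k))"
      by (intro sum.cong) (auto simp: algebra_simps)
    also have "\<dots> = ?e i j - 2 * c * (u $ i * u $ j) + c * c * (u $ i * u $ j) * s"
      using ij by (simp add: sum.distrib sum_subtractf sum_distrib_left[symmetric] s)
    also have "\<dots> = ?e i j + (c * c * s - 2 * c) * (u $ i * u $ j)"
      by (simp add: algebra_simps)
    finally show "(transpose_mat A * A) $$ (i, j) = 1\<^sub>m d $$ (i, j)"
      using ij cs by simp
  qed (auto simp: A_eq)
  then show "A \<in> carrier (orthogonal_group d)"
    by (simp add: orthogonal_group_def) (simp add: A_eq)
qed

end

theory Submission
  imports Defs
begin

text \<open>
  Let \<open>K\<close> be a closed fundamental chamber of \<open>G\<close>. Each orbit meets \<open>K\<close>, and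
  \<open>\<langle>g x, y\<rangle> \<le> \<langle>x, y\<rangle>\<close> for \<open>x, y \<in> K\<close>. Hence on \<open>K\<close> the orbit distance is the Euclidean one,
  and max filtering with a template \<open>t \<in> K\<close> is the linear form \<open>\<langle>t, \<cdot>\<rangle>\<close>, so it remains to find
  vectors in \<open>K\<close> which form a well conditioned frame.

  Take the basis \<open>\<omega>\<^sub>a\<close> dual to the simple roots \<open>a \<in> D\<close> (unit vectors), together with the
  projections of the standard basis to the space fixed by \<open>G\<close>. Simple roots are pairwise obtuse, so
  their Gram matrix is at most \<open>2\<close>, which gives the lower frame bound. For the upper one,
  the orbit of \<open>\<omega>\<^sub>a\<close> has \<open>N\<^sub>a \<le> m / |D|\<close> points, because the stabilizer contains the identity and
  the other \<open>|D| - 1\<close> simple reflections. This orbit is connected by steps of length at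
  most \<open>2\<close> and sums to \<open>0\<close>, whence \<open>|\<omega>\<^sub>a| \<le> 2 N\<^sub>a\<close> and \<open>\<Sum>\<^sub>a |\<omega>\<^sub>a|\<^sup>2 \<le> 4 m\<^sup>2\<close>.
\<close>

section \<open>Walks with bounded steps on the real line\<close>

text \<open>The bound counts visited values instead of steps. If the last value was visited before,
  its index can be replaced by an earlier one; if it is fresh, the cardinality grows by one, which
  pays for the last step of length at most \<open>s\<close>.\<close>

lemma walk_diameter:
  fixes h :: "nat \<Rightarrow> real"
  assumes "\<And>j. j < n \<Longrightarrow> \<bar>h (Suc j) - h j\<bar> \<le> s" "i \<le> n" "j \<le> n"
  shows "\<bar>h i - h j\<bar> \<le> s * (real (card (h ` {..n})) - 1)"
  using assms
proof (induction n arbitrary: i j)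
  case 0
  then show ?case by simp
next
  case (Suc n)
  have IH: "\<bar>h i - h j\<bar> \<le> s * (real (card (h ` {..n})) - 1)" if "i \<le> n" "j \<le> n" for i j
    using Suc.IH[OF _ that] Suc.prems(1) by simp
  have img: "h ` {..Suc n} = insert (h (Suc n)) (h ` {..n})"
    by (simp add: atMost_Suc)
  show ?case
  proof (cases "h (Suc n) \<in> h ` {..n}")
    case True
    then obtain l where l: "l \<le> n" "h (Suc n) = h l" by auto
    obtain i' where "i' \<le> n" "h i' = h i" using Suc.prems(2) l by (metis le_Suc_eq)
    moreover obtain j' where "j' \<le> n" "h j' = h j" using Suc.prems(3) l by (metis le_Suc_eq)
    ultimately show ?thesis using IH[of i' j'] img True by (simp add: insert_absorb)
  next
    case False
    then have card: "real (card (h ` {..Suc n})) = real (card (h ` {..n})) + 1"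
      using img by simp
    have s: "0 \<le> s" using Suc.prems(1)[of 0] by simp
    have step: "\<bar>h l - h (Suc n)\<bar> \<le> s * real (card (h ` {..n}))" if "l \<le> n" for l
      using IH[OF that, of n] Suc.prems(1)[of n] by (simp add: algebra_simps)
    consider "i \<le> n" "j \<le> n" | "i \<le> n" "j = Suc n" | "i = Suc n" "j \<le> n" | "i = j"
      using Suc.prems(2,3) by (metis le_Suc_eq)
    then show ?thesis
    proof cases
      case 1
      then show ?thesis using IH[OF 1] s by (simp add: card algebra_simps)
    next
      case 2
      then show ?thesis using step[of i] by (simp add: card)
    next
      case 3
      then show ?thesis using step[of j] by (simp add: card abs_minus_commute)
    next
      case 4
      then show ?thesis using s by (simp add: card)
    qed
  qed
qed

section \<open>Scalar products and linear combinations\<close>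

lemma scalar_prod_self_nonneg: "0 \<le> (x :: real vec) \<bullet> x"
  by (simp add: scalar_prod_def sum_nonneg)

lemma scalar_prod_self_eq_0:
  fixes x :: "real vec"
  assumes "x \<bullet> x = 0" "x \<in> carrier_vec d"
  shows "x = 0\<^sub>v d"
proof -
  have "\<forall>k \<in> {0..<d}. x $ k * x $ k = 0"
    using assms by (subst sum_nonneg_eq_0_iff[symmetric]) (auto simp: scalar_prod_def)
  then show ?thesis
    using assms(2) by (intro eq_vecI) auto
qed

text \<open>Coefficients are indexed by the vectors themselves, so finite sets of roots need no
  enumeration. The coordinatewise form has dimension \<open>d\<close> even when \<open>B\<close> is
  empty.\<close>

definition lin_comb :: "nat \<Rightarrow> real vec set \<Rightarrow> (real vec \<Rightarrow> real) \<Rightarrow> real vec" where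
  "lin_comb d B c = vec d (\<lambda>i. \<Sum>b\<in>B. c b * b $ i)"

text \<open>The reflection in the hyperplane orthogonal to \<open>a\<close>, for unit vectors \<open>a\<close> only.\<close>

definition refl_vec :: "real vec \<Rightarrow> real vec \<Rightarrow> real vec" where
  "refl_vec a x = x - (2 * (a \<bullet> x)) \<cdot>\<^sub>v a"

text \<open>Words stand for group elements because the arguments below induct on their length. The
  last letter acts first.\<close>

fun refl_word :: "real vec list \<Rightarrow> real vec \<Rightarrow> real vec" where
  "refl_word [] x = x"
| "refl_word (a # ws) x = refl_vec a (refl_word ws x)"

locale dimension =
  fixes d :: nat
begin

abbreviation V :: "real vec set" where "V \<equiv> carrier_vec d"
abbreviation comb where "comb \<equiv> lin_comb d"

lemma comb_carrier [simp]: "comb B c \<in> V"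
  by (simp add: lin_comb_def)

lemma scalar_prod_bilinear:
  assumes "x \<in> V" "y \<in> V" "z \<in> V"
  shows "(x + y) \<bullet> z = x \<bullet> z + y \<bullet> z" "z \<bullet> (x + y) = z \<bullet> x + z \<bullet> y"
    "(x - y) \<bullet> z = x \<bullet> z - y \<bullet> z" "z \<bullet> (x - y) = z \<bullet> x - z \<bullet> y"
    "(k \<cdot>\<^sub>v x) \<bullet> z = k * (x \<bullet> z)" "z \<bullet> (k \<cdot>\<^sub>v x) = k * (z \<bullet> x)"
    "(- x) \<bullet> z = - (x \<bullet> z)" "z \<bullet> (- x) = - (z \<bullet> x)"
  using assms by (auto simp: scalar_prod_def algebra_simps sum.distrib sum_subtractf
      sum_distrib_left sum_negf)

lemma scalar_prod_comm: "x \<in> V \<Longrightarrow> y \<in> V \<Longrightarrow> (x :: real vec) \<bullet> y = y \<bullet> x"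
  by (rule comm_scalar_prod)

lemma scalar_prod_comb_right:
  assumes "x \<in> V" "B \<subseteq> V"
  shows "x \<bullet> comb B c = (\<Sum>b\<in>B. c b * (x \<bullet> b))"
proof -
  have "x \<bullet> comb B c = (\<Sum>i = 0..<d. \<Sum>b\<in>B. c b * (x $ i * b $ i))"
    by (simp add: scalar_prod_def lin_comb_def sum_distrib_left mult_ac)
  also have "\<dots> = (\<Sum>b\<in>B. \<Sum>i = 0..<d. c b * (x $ i * b $ i))"
    by (rule sum.swap)
  also have "\<dots> = (\<Sum>b\<in>B. c b * (x \<bullet> b))"
    using assms by (intro sum.cong) (auto simp: scalar_prod_def sum_distrib_left)
  finally show ?thesis .
qed

lemma scalar_prod_comb_left:
  assumes "x \<in> V" "B \<subseteq> V"
  shows "comb B c \<bullet> x = (\<Sum>b\<in>B. c b * (b \<bullet> x))"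
proof -
  have "comb B c \<bullet> x = x \<bullet> comb B c"
    using assms by (intro scalar_prod_comm) auto
  also have "\<dots> = (\<Sum>b\<in>B. c b * (b \<bullet> x))"
    using assms by (subst scalar_prod_comb_right) (auto intro!: sum.cong simp: scalar_prod_comm subset_iff)
  finally show ?thesis .
qed

lemma comb_remove:
  assumes "finite B" "b \<in> B" "B \<subseteq> V"
  shows "comb B c = c b \<cdot>\<^sub>v b + comb (B - {b}) c"
  using assms by (intro eq_vecI) (auto simp: lin_comb_def sum.remove)

lemma comb_add: "B \<subseteq> V \<Longrightarrow> comb B c + comb B c' = comb B (\<lambda>b. c b + c' b)"
  by (intro eq_vecI) (auto simp: lin_comb_def sum.distrib algebra_simps)

lemma comb_smult: "k \<cdot>\<^sub>v comb B c = comb B (\<lambda>b. k * c b)"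
  by (intro eq_vecI) (auto simp: lin_comb_def sum_distrib_left algebra_simps)

lemma comb_cong: "(\<And>b. b \<in> B \<Longrightarrow> c b = c' b) \<Longrightarrow> comb B c = comb B c'"
  by (auto simp: lin_comb_def intro!: eq_vecI sum.cong)

lemma comb_single:
  assumes "finite B" "b \<in> B" "B \<subseteq> V"
  shows "comb B (\<lambda>x. if x = b then k else 0) = k \<cdot>\<^sub>v b"
proof (rule eq_vecI)
  fix i assume "i < dim_vec (k \<cdot>\<^sub>v b)"
  then have "i < d" using assms by auto
  moreover have "(\<Sum>x\<in>B. (if x = b then k else 0) * x $ i) = (\<Sum>x\<in>B. if x = b then k * b $ i else 0)"
    by (intro sum.cong) auto
  ultimately show "comb B (\<lambda>x. if x = b then k else 0) $ i = (k \<cdot>\<^sub>v b) $ i"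
    using assms by (auto simp: lin_comb_def)
qed (use assms in \<open>auto simp: lin_comb_def\<close>)

section \<open>Reflections and their words acting on vectors\<close>

lemma refl_vec_carrier [simp]: "a \<in> V \<Longrightarrow> x \<in> V \<Longrightarrow> refl_vec a x \<in> V"
  by (simp add: refl_vec_def)

lemma refl_word_carrier [simp]: "set ws \<subseteq> V \<Longrightarrow> x \<in> V \<Longrightarrow> refl_word ws x \<in> V"
  by (induction ws) auto

lemma scalar_prod_refl_refl:
  assumes "a \<in> V" "a \<bullet> a = 1" "x \<in> V" "y \<in> V"
  shows "refl_vec a x \<bullet> refl_vec a y = x \<bullet> y"
  using assms by (simp add: refl_vec_def scalar_prod_bilinear scalar_prod_comm[of x a] scalar_prod_comm[of y a] algebra_simps)

lemma refl_vec_involutive: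
  assumes "a \<in> V" "a \<bullet> a = 1" "x \<in> V"
  shows "refl_vec a (refl_vec a x) = x"
proof -
  have "a \<bullet> refl_vec a x = - (a \<bullet> x)"
    using assms by (simp add: refl_vec_def scalar_prod_bilinear)
  then have "refl_vec a (refl_vec a x) = refl_vec a x + (2 * (a \<bullet> x)) \<cdot>\<^sub>v a"
    using assms by (intro eq_vecI) (auto simp: refl_vec_def[of a "refl_vec a x"])
  then show ?thesis
    using assms by (auto simp: refl_vec_def)
qed

lemma refl_vec_self: "a \<in> V \<Longrightarrow> a \<bullet> a = 1 \<Longrightarrow> refl_vec a a = - a"
  by (intro eq_vecI) (auto simp: refl_vec_def)

lemma refl_vec_uminus: "a \<in> V \<Longrightarrow> x \<in> V \<Longrightarrow> refl_vec (- a) x = refl_vec a x"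
  by (intro eq_vecI) (auto simp: refl_vec_def)

lemma refl_vec_linear:
  assumes "a \<in> V" "x \<in> V" "y \<in> V"
  shows "refl_vec a (x - k \<cdot>\<^sub>v y) = refl_vec a x - k \<cdot>\<^sub>v refl_vec a y"
  using assms by (intro eq_vecI) (auto simp: refl_vec_def scalar_prod_bilinear algebra_simps)

lemma refl_word_linear:
  assumes "set ws \<subseteq> V" "x \<in> V" "y \<in> V"
  shows "refl_word ws (x - k \<cdot>\<^sub>v y) = refl_word ws x - k \<cdot>\<^sub>v refl_word ws y"
  using assms by (induction ws) (auto simp: refl_vec_linear)

lemma refl_word_append: "refl_word (vs @ ws) x = refl_word vs (refl_word ws x)"
  by (induction vs) auto

lemma refl_word_isometry:
  assumes "set ws \<subseteq> V" "\<And>a. a \<in> set ws \<Longrightarrow> a \<bullet> a = 1" "x \<in> V" "y \<in> V"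
  shows "refl_word ws x \<bullet> refl_word ws y = x \<bullet> y"
  using assms by (induction ws) (auto simp: scalar_prod_refl_refl)

lemma refl_word_refl_vec:
  assumes "set ws \<subseteq> V" "\<And>a. a \<in> set ws \<Longrightarrow> a \<bullet> a = 1" "u \<in> V" "x \<in> V"
  shows "refl_word ws (refl_vec u x) = refl_vec (refl_word ws u) (refl_word ws x)"
  using assms by (simp add: refl_vec_def refl_word_linear refl_word_isometry)

lemma refl_word_rev:
  assumes "set ws \<subseteq> V" "\<And>a. a \<in> set ws \<Longrightarrow> a \<bullet> a = 1" "x \<in> V"
  shows "refl_word (rev ws) (refl_word ws x) = x"
  using assms by (induction ws) (auto simp: refl_word_append refl_vec_involutive)

text \<open>Comparing the two images of \<open>b\<close> shows that \<open>b\<close> is a multiple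
  of \<open>a\<close>, and unit length leaves only the two signs. A reflection therefore determines
  its unit root up to sign.\<close>

lemma refl_vec_eq_imp:
  assumes "a \<in> V" "a \<bullet> a = 1" "b \<in> V" "b \<bullet> b = 1" "refl_vec a b = refl_vec b b"
  shows "b = a \<or> b = - a"
proof -
  have "(2 * (a \<bullet> b)) \<cdot>\<^sub>v a = 2 \<cdot>\<^sub>v b"
  proof (rule eq_vecI)
    fix i assume "i < dim_vec (2 \<cdot>\<^sub>v b)"
    then have i: "i < d" using assms by auto
    have "refl_vec a b $ i = refl_vec b b $ i" using assms by simp
    then show "((2 * (a \<bullet> b)) \<cdot>\<^sub>v a) $ i = (2 \<cdot>\<^sub>v b) $ i"
      using i assms by (simp add: refl_vec_def)
  qed (use assms in auto)
  then have b: "b = (a \<bullet> b) \<cdot>\<^sub>v a"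
    using assms by (auto simp: vec_eq_iff)
  then have "1 = (a \<bullet> b) * (a \<bullet> b)"
    using assms by (metis scalar_prod_bilinear(5))
  then have "a \<bullet> b = 1 \<or> a \<bullet> b = - 1"
    by (simp add: square_eq_1_iff[symmetric])
  then show ?thesis
    using b assms by (auto simp: vec_eq_iff)
qed

lemma cauchy_schwarz:
  assumes "x \<in> V" "y \<in> V"
  shows "(x \<bullet> y)\<^sup>2 \<le> (x \<bullet> x) * (y \<bullet> (y :: real vec))"
proof (cases "y \<bullet> y = 0")
  case True
  then have "y = 0\<^sub>v d" using assms scalar_prod_self_eq_0 by blast
  then show ?thesis using assms by simp
next
  case False
  define k where "k = (x \<bullet> y) / (y \<bullet> y)"
  have k: "k * (y \<bullet> y) = x \<bullet> y" using False by (simp add: k_def)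
  have "0 \<le> (x - k \<cdot>\<^sub>v y) \<bullet> (x - k \<cdot>\<^sub>v y)"
    by (rule scalar_prod_self_nonneg)
  also have "\<dots> = x \<bullet> x - 2 * k * (x \<bullet> y) + k * (k * (y \<bullet> y))"
    using assms by (simp add: scalar_prod_bilinear scalar_prod_comm[of y x] algebra_simps)
  also have "\<dots> = x \<bullet> x - k * (x \<bullet> y)"
    by (simp add: k algebra_simps)
  finally have "k * (x \<bullet> y) * (y \<bullet> y) \<le> (x \<bullet> x) * (y \<bullet> y)"
    using scalar_prod_self_nonneg[of y] by (intro mult_right_mono) auto
  also have "k * (x \<bullet> y) * (y \<bullet> y) = (k * (y \<bullet> y)) * (x \<bullet> y)"
    by (simp only: mult_ac)
  finally show ?thesis by (simp add: k power2_eq_square)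
qed

lemma smult_vec_zero: "x \<in> V \<Longrightarrow> 0 \<cdot>\<^sub>v x = (0\<^sub>v d :: real vec)"
  by (auto simp: vec_eq_iff)

section \<open>Dual bases, generic vectors and minimal generating sets\<close>

text \<open>One Gram-Schmidt step per vector: the values on \<open>B\<close> are prescribed first,
  and a multiple of a vector orthogonal to \<open>B\<close> then corrects the value on
  \<open>a\<close> without disturbing them.\<close>

lemma dual_coefficients:
  assumes "finite B" "B \<subseteq> V" "\<And>c. comb B c = 0\<^sub>v d \<Longrightarrow> \<forall>b\<in>B. c b = 0"
  shows "\<exists>c. \<forall>b\<in>B. comb B c \<bullet> b = f b"
  using assms
proof (induction B arbitrary: f rule: finite_induct)
  case empty
  then show ?case by simp
next
  case (insert a B)
  have BV: "B \<subseteq> V" "a \<in> V" "insert a B - {a} = B"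
    using insert by auto
  have comb_insert: "comb (insert a B) c = c a \<cdot>\<^sub>v a + comb B c" for c
    using comb_remove[of "insert a B" a c] insert BV by simp
  have drop: "comb B c = comb B (c(a := k))" for c k
    using insert.hyps by (intro comb_cong) auto
  have indep: "\<forall>b\<in>B. c b = 0" if "comb B c = 0\<^sub>v d" for c
  proof -
    have "comb (insert a B) (c(a := 0)) = 0\<^sub>v d"
      using that BV by (auto simp: comb_insert drop[symmetric] smult_vec_zero)
    then have "\<forall>b\<in>insert a B. (c(a := 0)) b = 0"
      by (rule insert.prems(2))
    then show ?thesis
      using insert.hyps(2) by (metis fun_upd_other insertCI)
  qed
  note IH = insert.IH[OF BV(1) indep]
  obtain p where p: "\<forall>b\<in>B. comb B p \<bullet> b = a \<bullet> b"
    using IH[of "\<lambda>b. a \<bullet> b"] by blast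
  obtain q where q: "\<forall>b\<in>B. comb B q \<bullet> b = f b"
    using IH[of f] by blast
  \<comment> \<open>The residual of \<open>a\<close> after orthogonal projection to the span of
    \<open>B\<close>. Its coefficient 1 at \<open>a\<close> makes it nonzero by
    independence.\<close>
  define r where "r = comb (insert a B) ((\<lambda>b. - p b)(a := 1))"
  have r_eq: "r = a - comb B p"
    using BV drop[of "\<lambda>b. - p b" 1, symmetric] comb_smult[of "-1" B p]
    by (auto simp: r_def comb_insert vec_eq_iff)
  have r_orth: "r \<bullet> b = 0" if "b \<in> B" for b
    using that BV p by (auto simp: r_eq scalar_prod_bilinear subset_iff)
  have "r \<bullet> comb B p = 0"
    using BV r_orth by (simp add: scalar_prod_comb_right r_eq)
  then have rr: "r \<bullet> r = r \<bullet> a"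
    using BV by (subst (2) r_eq) (simp add: r_eq scalar_prod_bilinear)
  have "r \<bullet> a \<noteq> 0"
  proof
    assume "r \<bullet> a = 0"
    then have "r = 0\<^sub>v d"
      using rr scalar_prod_self_eq_0[of r d] by (simp add: r_def)
    then have "((\<lambda>b. - p b)(a := 1)) a = 0"
      using insert.prems(2)[of "(\<lambda>b. - p b)(a := 1)"] unfolding r_def by blast
    then show False by simp
  qed
  define t where "t = (f a - comb B q \<bullet> a) / (r \<bullet> a)"
  have "comb (insert a B) (q(a := 0)) = comb B q"
    using BV by (simp add: comb_insert drop[symmetric] smult_vec_zero)
  then have "comb (insert a B) (\<lambda>b. (q(a := 0)) b + t * ((\<lambda>b. - p b)(a := 1)) b) = comb B q + t \<cdot>\<^sub>v r"
    using BV comb_add[of "insert a B" "q(a := 0)" "\<lambda>b. t * ((\<lambda>b. - p b)(a := 1)) b"]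
    by (simp only: r_def comb_smult) simp
  moreover have "(comb B q + t \<cdot>\<^sub>v r) \<bullet> b = f b" if "b \<in> insert a B" for b
    using that BV q r_orth \<open>r \<bullet> a \<noteq> 0\<close> 
    by (auto simp: scalar_prod_bilinear r_def t_def subset_iff)
  ultimately show ?case by metis
qed

text \<open>The vector found for \<open>R\<close> is shifted along the new \<open>u\<close>. Every
  \<open>a\<close> with \<open>u \<bullet> a \<noteq> 0\<close> rules out a single shift
  \<open>k\<close>; if \<open>u \<bullet> a = 0\<close>, then \<open>a\<close> lies in
  \<open>R\<close> and the shift leaves its product unchanged.\<close>

lemma exists_generic:
  assumes "finite R" "\<And>a. a \<in> R \<Longrightarrow> a \<in> V \<and> a \<bullet> a \<noteq> 0"
  shows "\<exists>\<rho>\<in>V. \<forall>a\<in>R. \<rho> \<bullet> a \<noteq> 0"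
  using assms
proof (induction R rule: finite_induct)
  case empty
  then show ?case by (auto intro: exI[of _ "0\<^sub>v d"])
next
  case (insert u R)
  then obtain \<rho> where \<rho>: "\<rho> \<in> V" "\<forall>a\<in>R. \<rho> \<bullet> a \<noteq> 0" by auto
  have uV: "u \<in> V" "u \<bullet> u \<noteq> 0" "\<And>a. a \<in> R \<Longrightarrow> a \<in> V" using insert by auto
  have "finite ((\<lambda>a. - (\<rho> \<bullet> a) / (u \<bullet> a)) ` insert u R \<union> {0})"
    using insert by auto
  then obtain k where k: "k \<notin> (\<lambda>a. - (\<rho> \<bullet> a) / (u \<bullet> a)) ` insert u R \<union> {0}"
    using ex_new_if_finite[OF infinite_UNIV_char_0] by blast
  have "(\<rho> + k \<cdot>\<^sub>v u) \<bullet> a \<noteq> 0" if a: "a \<in> insert u R" for a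
  proof
    assume *: "(\<rho> + k \<cdot>\<^sub>v u) \<bullet> a = 0"
    have "a \<in> V" using a uV by auto
    then have eq: "\<rho> \<bullet> a + k * (u \<bullet> a) = 0"
      using * \<rho> uV by (simp add: scalar_prod_bilinear)
    show False
    proof (cases "u \<bullet> a = 0")
      case True
      then show False using eq \<rho> a uV(2) by auto
    next
      case False
      then have "k = - (\<rho> \<bullet> a) / (u \<bullet> a)"
        using eq by (simp add: field_simps)
      then show False using k a by blast
    qed
  qed
  then show ?case using \<rho>(1) uV(1) by (intro bexI[of _ "\<rho> + k \<cdot>\<^sub>v u"]) auto
qed

text \<open>A generating subset of least cardinality works: a redundant \<open>b\<close> could be
  substituted away, leaving a smaller one. Applied to the positive roots, this yields the simple
  roots.\<close>

lemma exists_minimal_generators: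
  assumes "finite P" "P \<subseteq> V"
  shows "\<exists>D\<subseteq>P. (\<forall>a\<in>P. \<exists>c. (\<forall>b\<in>D. 0 \<le> c b) \<and> a = comb D c) \<and>
    (\<forall>b\<in>D. \<nexists>c. (\<forall>e\<in>D - {b}. 0 \<le> c e) \<and> b = comb (D - {b}) c)"
proof -
  define gen where "gen D \<longleftrightarrow> D \<subseteq> P \<and> (\<forall>a\<in>P. \<exists>c. (\<forall>b\<in>D. 0 \<le> c b) \<and> a = comb D c)" for D
  have "gen P"
    unfolding gen_def
  proof (intro conjI ballI)
    fix a assume "a \<in> P"
    then have "a = comb P (\<lambda>x. if x = a then 1 else 0)"
      using assms by (subst comb_single) auto
    then show "\<exists>c. (\<forall>b\<in>P. 0 \<le> c b) \<and> a = comb P c"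
      by (intro exI[of _ "\<lambda>x. if x = a then 1 else 0"]) auto
  qed simp
  then obtain D where D: "gen D" and min: "\<And>E. gen E \<Longrightarrow> card D \<le> card E"
    using ex_has_least_nat[of gen P card] by auto
  have DP: "D \<subseteq> P" "finite D" "D \<subseteq> V"
    using D assms by (auto simp: gen_def intro: finite_subset)
  have False if b: "b \<in> D" and c: "\<forall>e\<in>D - {b}. 0 \<le> c e" "b = comb (D - {b}) c" for b c
  proof -
    have "gen (D - {b})"
      unfolding gen_def
    proof (intro conjI ballI)
      fix a assume "a \<in> P"
      then obtain k where k: "\<forall>b\<in>D. 0 \<le> k b" "a = comb D k"
        using D by (auto simp: gen_def)
      have "a = k b \<cdot>\<^sub>v b + comb (D - {b}) k"
        using k DP b comb_remove by blast
      also have "k b \<cdot>\<^sub>v b = comb (D - {b}) (\<lambda>e. k b * c e)"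
        by (subst c(2)) (rule comb_smult)
      also have "\<dots> + comb (D - {b}) k = comb (D - {b}) (\<lambda>e. k b * c e + k e)"
        using DP by (intro comb_add) auto
      finally show "\<exists>c. (\<forall>e\<in>D - {b}. 0 \<le> c e) \<and> a = comb (D - {b}) c"
        using k b c by (intro exI[of _ "\<lambda>e. k b * c e + k e"]) auto
    qed (use DP in auto)
    then have "card D \<le> card (D - {b})" by (rule min)
    then show False using card_Diff1_less[OF DP(2) b] by simp
  qed
  then show ?thesis
    using D by (intro exI[of _ D]) (auto simp: gen_def)
qed

end

subsection \<open>Simple systems of roots\<close>

text \<open>The generic \<open>\<rho>\<close> separates positive from negative roots. Simple roots
  are encoded as an irredundant set of generators of the positive cone; obtuseness and linear
  independence are then consequences.\<close>

locale simple_system = dimension +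
  fixes R D :: "real vec set" and \<rho> :: "real vec"
  assumes finite_roots: "finite R"
    and roots_carrier: "R \<subseteq> V"
    and root_unit: "\<And>a. a \<in> R \<Longrightarrow> a \<bullet> a = 1"
    and roots_closed: "\<And>a b. a \<in> R \<Longrightarrow> b \<in> R \<Longrightarrow> refl_vec a b \<in> R"
    and rho_carrier: "\<rho> \<in> V"
    and rho_generic: "\<And>a. a \<in> R \<Longrightarrow> \<rho> \<bullet> a \<noteq> 0"
    and simple_positive: "D \<subseteq> {a \<in> R. 0 < \<rho> \<bullet> a}"
    and simple_generate:
      "\<And>a. a \<in> R \<Longrightarrow> 0 < \<rho> \<bullet> a \<Longrightarrow> \<exists>c. (\<forall>b\<in>D. 0 \<le> c b) \<and> a = comb D c"
    and simple_minimal: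
      "\<And>b c. b \<in> D \<Longrightarrow> (\<forall>e\<in>D - {b}. 0 \<le> c e) \<Longrightarrow> b \<noteq> comb (D - {b}) c"
begin

abbreviation P :: "real vec set" where "P \<equiv> {a \<in> R. 0 < \<rho> \<bullet> a}"

lemma simpleD: "a \<in> D \<Longrightarrow> a \<in> R" "a \<in> D \<Longrightarrow> a \<in> V" "a \<in> D \<Longrightarrow> a \<bullet> a = 1" "a \<in> D \<Longrightarrow> 0 < \<rho> \<bullet> a"
  using simple_positive roots_carrier root_unit by auto

lemma rootD: "a \<in> R \<Longrightarrow> a \<in> V" "a \<in> R \<Longrightarrow> a \<bullet> a = 1"
  using roots_carrier root_unit by auto

lemma finite_simple: "finite D" and simple_carrier: "D \<subseteq> V"
  using simple_positive finite_roots roots_carrier by (auto intro: finite_subset)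

lemma uminus_root: "a \<in> R \<Longrightarrow> - a \<in> R"
  using roots_closed[of a a] rootD[of a] by (simp add: refl_vec_self)

lemma negative_rootD: "a \<in> R \<Longrightarrow> \<not> 0 < \<rho> \<bullet> a \<Longrightarrow> - a \<in> P"
  using rho_generic[of a] uminus_root[of a] rootD[of a] rho_carrier
  by (auto simp: scalar_prod_bilinear)

text \<open>A positive \<open>t\<close> could be divided out, against minimality. For
  \<open>t \<le> 0\<close>, pairing with \<open>\<rho>\<close>, which is positive on
  \<open>D\<close>, makes a sum of nonnegative terms nonpositive.\<close>

lemma simple_irredundant:
  assumes b: "b \<in> D" and c: "\<forall>e\<in>D - {b}. 0 \<le> c e" and eq: "t \<cdot>\<^sub>v b = comb (D - {b}) c"
  shows "\<forall>e\<in>D - {b}. c e = 0"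
proof -
  have "\<not> t > 0"
  proof
    assume t: "t > 0"
    have "b = (1 / t) \<cdot>\<^sub>v (t \<cdot>\<^sub>v b)" using t by (simp add: vec_eq_iff)
    also have "\<dots> = comb (D - {b}) (\<lambda>e. 1 / t * c e)"
      by (simp only: eq comb_smult)
    finally show False
      using simple_minimal[OF b, of "\<lambda>e. 1 / t * c e"] c t by simp
  qed
  moreover have "t * (\<rho> \<bullet> b) = (\<Sum>e\<in>D - {b}. c e * (\<rho> \<bullet> e))"
    using arg_cong[OF eq, of "\<lambda>x. \<rho> \<bullet> x"] b simple_carrier rho_carrier
    by (auto simp: scalar_prod_bilinear scalar_prod_comb_right subset_iff)
  ultimately have "(\<Sum>e\<in>D - {b}. c e * (\<rho> \<bullet> e)) \<le> 0"
    using simpleD(4)[OF b] by (metis less_eq_real_def linorder_not_le mult_nonpos_nonneg)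
  moreover have nn: "0 \<le> c e * (\<rho> \<bullet> e)" if "e \<in> D - {b}" for e
    using that c simpleD(4)[of e] by (auto intro!: mult_nonneg_nonneg)
  ultimately have "(\<Sum>e\<in>D - {b}. c e * (\<rho> \<bullet> e)) = 0"
    by (meson antisym sum_nonneg)
  then have "\<forall>e\<in>D - {b}. c e * (\<rho> \<bullet> e) = 0"
    using nn finite_simple by (subst (asm) sum_nonneg_eq_0_iff) auto
  then show ?thesis using simpleD(4) by fastforce
qed

text \<open>If \<open>a \<bullet> b > 0\<close>, the root \<open>b - c \<cdot>\<^sub>v a\<close> or
  its negative is a nonnegative combination of \<open>D\<close>. Collecting terms writes a multiple
  of \<open>b\<close> or of \<open>a\<close> through the other simple roots with a positive
  coefficient, which \<open>simple_irredundant\<close> excludes.\<close>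

lemma simple_obtuse:
  assumes "a \<in> D" "b \<in> D" "a \<noteq> b"
  shows "a \<bullet> b \<le> 0"
proof (rule ccontr)
  assume "\<not> a \<bullet> b \<le> 0"
  define c where "c = 2 * (a \<bullet> b)"
  have c: "c > 0" using \<open>\<not> a \<bullet> b \<le> 0\<close> by (simp add: c_def)
  define r where "r = refl_vec a b"
  have ab: "a \<in> V" "b \<in> V" "dim_vec a = d" "dim_vec b = d" using assms simpleD by auto
  have r: "r \<in> R" "r = b - c \<cdot>\<^sub>v a"
    using roots_closed simpleD assms by (auto simp: r_def refl_vec_def c_def)
  have sub: "D - {e} \<subseteq> V" "finite (D - {e})" for e
    using simple_carrier finite_simple by auto
  show False
  proof (cases "\<rho> \<bullet> r > 0")
    case True
    then obtain k where k: "\<forall>e\<in>D. 0 \<le> k e" "r = comb D k"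
      using simple_generate r by blast
    have "b - c \<cdot>\<^sub>v a = k b \<cdot>\<^sub>v b + comb (D - {b}) k"
      using k(2) r(2) comb_remove[OF finite_simple assms(2) simple_carrier] by simp
    then have "(1 - k b) \<cdot>\<^sub>v b = comb (D - {b}) k + c \<cdot>\<^sub>v a"
      using ab by (auto simp: vec_eq_iff algebra_simps lin_comb_def)
    also have "\<dots> = comb (D - {b}) (\<lambda>e. k e + (if e = a then c else 0))"
      using comb_single[of "D - {b}" a c] sub assms by (simp add: comb_add[symmetric])
    finally have "\<forall>e\<in>D - {b}. k e + (if e = a then c else 0) = 0"
      using k c by (intro simple_irredundant[OF assms(2)]) auto
    then show False using assms k c by force
  next
    case False
    then have "- r \<in> P" using r negative_rootD by blast
    then obtain k where k: "\<forall>e\<in>D. 0 \<le> k e" "- r = comb D k"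
      using simple_generate by blast
    have "- (b - c \<cdot>\<^sub>v a) = k a \<cdot>\<^sub>v a + comb (D - {a}) k"
      using k(2) r(2) comb_remove[OF finite_simple assms(1) simple_carrier] by simp
    then have "(c - k a) \<cdot>\<^sub>v a = comb (D - {a}) k + 1 \<cdot>\<^sub>v b"
      using ab by (auto simp: vec_eq_iff algebra_simps lin_comb_def)
    also have "\<dots> = comb (D - {a}) (\<lambda>e. k e + (if e = b then 1 else 0))"
      using comb_single[of "D - {a}" b 1] sub assms by (simp add: comb_add[symmetric])
    finally have "\<forall>e\<in>D - {a}. k e + (if e = b then 1 else 0) = 0"
      using k c by (intro simple_irredundant[OF assms(1)]) auto
    then show False using assms k c by force
  qed
qed

lemma scalar_prod_comb_comb:
  "comb D c \<bullet> comb D k = (\<Sum>a\<in>D. \<Sum>b\<in>D. c a * k b * (a \<bullet> b))"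
proof -
  have "comb D c \<bullet> comb D k = (\<Sum>a\<in>D. c a * (\<Sum>b\<in>D. k b * (a \<bullet> b)))"
    using simple_carrier
    by (subst scalar_prod_comb_left) (auto simp: scalar_prod_comb_right subset_iff intro!: sum.cong)
  then show ?thesis by (simp add: sum_distrib_left mult_ac)
qed

lemma nonneg_comb_eq_0:
  assumes "\<forall>a\<in>D. 0 \<le> k a" "comb D k = 0\<^sub>v d" "a \<in> D"
  shows "k a = 0"
proof -
  have "(\<Sum>a\<in>D. k a * (\<rho> \<bullet> a)) = 0"
    using arg_cong[OF assms(2), of "\<lambda>x. \<rho> \<bullet> x"] rho_carrier simple_carrier
    by (simp add: scalar_prod_comb_right)
  then have "\<forall>a\<in>D. k a * (\<rho> \<bullet> a) = 0"
    using assms simpleD(4) finite_simple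
    by (subst (asm) sum_nonneg_eq_0_iff) (auto intro!: mult_nonneg_nonneg simp: less_imp_le)
  then show ?thesis using assms(3) simpleD(4) by fastforce
qed

text \<open>Split the coefficients into positive and negative parts. The two combinations agree,
  while their scalar product is nonpositive: distinct roots are obtuse, and no root has both parts
  nonzero. Hence both vanish, and pairing with \<open>\<rho>\<close> kills the coefficients.\<close>

lemma simple_independent:
  assumes "comb D k = 0\<^sub>v d"
  shows "\<forall>a\<in>D. k a = 0"
proof -
  define p where "p a = max (k a) 0" for a
  define n where "n a = max (- k a) 0" for a
  have k: "k = (\<lambda>a. p a + - 1 * n a)" by (auto simp: p_def n_def fun_eq_iff)
  have "comb D p + (- 1) \<cdot>\<^sub>v comb D n = 0\<^sub>v d"
    using assms simple_carrier by (subst (asm) k) (simp only: comb_smult comb_add)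
  then have eq: "comb D p = comb D n"
    by (auto simp: vec_eq_iff lin_comb_def)
  have "comb D p \<bullet> comb D n \<le> 0"
    unfolding scalar_prod_comb_comb
  proof (intro sum_nonpos)
    fix a b assume ab: "a \<in> D" "b \<in> D"
    show "p a * n b * (a \<bullet> b) \<le> 0"
    proof (cases "a = b")
      case True
      then have "p a * n b = 0" by (auto simp: p_def n_def max_def)
      then show ?thesis by (simp only: mult_zero_left order_refl)
    next
      case False
      then show ?thesis
        using simple_obtuse[OF ab False] by (intro mult_nonneg_nonpos) (auto simp: p_def n_def)
    qed
  qed
  then have "comb D p \<bullet> comb D p = 0"
    using scalar_prod_self_nonneg[of "comb D p"] eq by simp
  then have "comb D p = 0\<^sub>v d" by (rule scalar_prod_self_eq_0) simp
  then have "\<forall>a\<in>D. p a = 0" "\<forall>a\<in>D. n a = 0"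
    using nonneg_comb_eq_0[of p] nonneg_comb_eq_0[of n] eq by (auto simp: p_def n_def)
  then show ?thesis by (simp add: k)
qed

text \<open>The off-diagonal entries of the Gram matrix are nonpositive, so adding the squared norms
  of the combinations with coefficients \<open>k\<close> and \<open>\<bar>k\<bar>\<close> leaves at most the diagonal.\<close>

lemma norm_comb_le:
  "comb D k \<bullet> comb D k \<le> 2 * (\<Sum>a\<in>D. (k a)\<^sup>2)"
proof -
  define l where "l a = \<bar>k a\<bar>" for a
  have "comb D k \<bullet> comb D k \<le> comb D k \<bullet> comb D k + comb D l \<bullet> comb D l"
    using scalar_prod_self_nonneg[of "comb D l"] by simp
  also have "\<dots> = (\<Sum>a\<in>D. \<Sum>b\<in>D. (k a * k b + \<bar>k a * k b\<bar>) * (a \<bullet> b))"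
    by (simp add: scalar_prod_comb_comb l_def sum.distrib algebra_simps abs_mult)
  also have "\<dots> \<le> (\<Sum>a\<in>D. \<Sum>b\<in>D. if a = b then 2 * (k a)\<^sup>2 else 0)"
  proof (intro sum_mono)
    fix a b assume ab: "a \<in> D" "b \<in> D"
    show "(k a * k b + \<bar>k a * k b\<bar>) * (a \<bullet> b) \<le> (if a = b then 2 * (k a)\<^sup>2 else 0)"
    proof (cases "a = b")
      case True
      then show ?thesis using simpleD(3)[OF ab(1)] by (simp add: power2_eq_square)
    next
      case False
      have "(k a * k b + \<bar>k a * k b\<bar>) * (a \<bullet> b) \<le> 0"
        using simple_obtuse[OF ab False] by (intro mult_nonneg_nonpos) auto
      then show ?thesis using False by simp
    qed
  qed
  also have "\<dots> = 2 * (\<Sum>a\<in>D. (k a)\<^sup>2)"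
    using finite_simple by (simp add: sum_distrib_left)
  finally show ?thesis .
qed

section \<open>Words in simple reflections and the exchange condition\<close>

text \<open>The reflection in \<open>a\<close> changes only the coefficient at \<open>a\<close>. If
  the image were negative, all other coefficients of \<open>u\<close> would vanish, and a positive
  unit multiple of \<open>a\<close> is \<open>a\<close>.\<close>

lemma simple_reflection_positive:
  assumes a: "a \<in> D" and u: "u \<in> P" and neq: "u \<noteq> a"
  shows "refl_vec a u \<in> P"
proof (rule ccontr)
  assume "refl_vec a u \<notin> P"
  moreover have uR: "refl_vec a u \<in> R" using a u roots_closed simpleD by blast
  ultimately have "- refl_vec a u \<in> P" using negative_rootD by blast
  then obtain k where k: "\<forall>b\<in>D. 0 \<le> k b" "- refl_vec a u = comb D k"
    using simple_generate by blast
  obtain c where c: "\<forall>b\<in>D. 0 \<le> c b" "u = comb D c"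
    using simple_generate u by blast
  define t where "t = 2 * (a \<bullet> u)"
  have V: "a \<in> V" "u \<in> V" "dim_vec a = d" "dim_vec u = d" using a u simpleD rootD by auto
  have "comb D k + comb D c + (- t) \<cdot>\<^sub>v a = 0\<^sub>v d"
    unfolding k(2)[symmetric] c(2)[symmetric] using V by (auto simp: refl_vec_def t_def vec_eq_iff)
  then have "comb D (\<lambda>b. k b + c b + (if b = a then - t else 0)) = 0\<^sub>v d"
    using comb_single[OF finite_simple a simple_carrier, of "- t"] simple_carrier
    by (simp add: comb_add[symmetric])
  then have "\<forall>b\<in>D. k b + c b + (if b = a then - t else 0) = 0"
    by (rule simple_independent)
  then have c0: "c b = 0" if "b \<in> D" "b \<noteq> a" for b
    using that k c by (smt (verit, best))
  have "u = comb D (\<lambda>b. if b = a then c a else 0)"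
    unfolding c(2) by (rule comb_cong) (auto simp: c0)
  then have ua: "u = c a \<cdot>\<^sub>v a"
    using comb_single[OF finite_simple a simple_carrier] by simp
  then have "u \<bullet> u = c a * (c a * (a \<bullet> a))"
    using V by (metis (no_types, lifting) scalar_prod_bilinear(5,6) smult_carrier_vec)
  then have "c a * c a = 1" using simpleD(3)[OF a] u rootD by auto
  then have "c a = 1" using c a by (metis abs_of_nonneg real_sqrt_abs2 real_sqrt_one)
  then show False using ua neq by simp
qed

lemma simple_wordD:
  assumes "set ws \<subseteq> D"
  shows "set ws \<subseteq> V" "\<And>a. a \<in> set ws \<Longrightarrow> a \<bullet> a = 1"
  using assms simpleD by auto

text \<open>Take the positive root \<open>v\<close> reachable from \<open>u\<close> with least
  \<open>\<rho> \<bullet> v\<close>. Since \<open>v \<bullet> v > 0\<close>, some simple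
  \<open>a\<close> has \<open>a \<bullet> v > 0\<close>; reflecting in it would lower the value
  further and stay positive, unless \<open>v = a\<close>.\<close>

lemma positive_conj_simple:
  assumes u: "u \<in> P"
  shows "\<exists>ws. set ws \<subseteq> D \<and> refl_word ws u \<in> D"
proof -
  define M where "M = {v \<in> P. \<exists>ws. set ws \<subseteq> D \<and> v = refl_word ws u}"
  have "u \<in> M" using u by (auto simp: M_def intro: exI[of _ "[]"])
  moreover have "finite M" using finite_roots by (auto simp: M_def)
  ultimately obtain v where v: "v \<in> M" and min: "\<And>w. w \<in> M \<Longrightarrow> \<rho> \<bullet> v \<le> \<rho> \<bullet> w"
    by (metis arg_min_if_finite(1) arg_min_least empty_iff)
  obtain ws where ws: "set ws \<subseteq> D" "v = refl_word ws u" and vP: "v \<in> P"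
    using v by (auto simp: M_def)
  obtain c where c: "\<forall>b\<in>D. 0 \<le> c b" "v = comb D c"
    using simple_generate vP by blast
  have vV: "v \<in> V" "v \<bullet> v = 1" using vP rootD by auto
  have "v \<bullet> v = (\<Sum>a\<in>D. c a * (a \<bullet> v))"
    using c(2) scalar_prod_comb_left[OF vV(1) simple_carrier] by metis
  then have "\<not> (\<forall>a\<in>D. c a * (a \<bullet> v) \<le> 0)"
    using vV(2) sum_nonpos[of D "\<lambda>a. c a * (a \<bullet> v)"] by auto
  then obtain a where a: "a \<in> D" "0 < c a * (a \<bullet> v)" by force
  then have av: "0 < a \<bullet> v" using c(1) by (auto simp: zero_less_mult_iff)
  have "v = a"
  proof (rule ccontr)
    assume "v \<noteq> a"
    then have "refl_vec a v \<in> M"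
      using simple_reflection_positive[OF a(1) vP] ws a
      by (auto simp: M_def intro!: exI[of _ "a # ws"])
    then have "\<rho> \<bullet> v \<le> \<rho> \<bullet> refl_vec a v" by (rule min)
    also have "\<dots> = \<rho> \<bullet> v - 2 * (a \<bullet> v) * (\<rho> \<bullet> a)"
      using vV simpleD[OF a(1)] rho_carrier by (simp add: refl_vec_def scalar_prod_bilinear)
    finally show False using av simpleD(4)[OF a(1)] by (simp add: mult_le_0_iff)
  qed
  then show ?thesis using ws a by auto
qed

text \<open>A word carrying \<open>u\<close> to a simple root conjugates the reflection in
  \<open>u\<close> to a simple one. A negative root has the same reflection as its opposite.\<close>

lemma reflection_simple_word:
  assumes u: "u \<in> R"
  shows "\<exists>ws. set ws \<subseteq> D \<and> (\<forall>x\<in>V. refl_vec u x = refl_word ws x)"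
proof -
  have *: "\<exists>ws. set ws \<subseteq> D \<and> (\<forall>x\<in>V. refl_vec u x = refl_word ws x)" if u: "u \<in> P" for u
  proof -
    obtain ws where ws: "set ws \<subseteq> D" "refl_word ws u \<in> D"
      using positive_conj_simple[OF u] by blast
    note wsD = simple_wordD[OF ws(1)]
    have "refl_vec u x = refl_word (rev ws @ refl_word ws u # ws) x" if "x \<in> V" for x
      using refl_word_refl_vec[OF wsD, of u x] refl_word_rev[OF wsD, of "refl_vec u x"] that u rootD
      by (auto simp: refl_word_append)
    then show ?thesis
      using ws by (intro exI[of _ "rev ws @ refl_word ws u # ws"]) auto
  qed
  show ?thesis
  proof (cases "u \<in> P")
    case False
    then have "- u \<in> P" using negative_rootD u by blast
    from *[OF this] show ?thesis using rootD(1)[OF u] by (simp add: refl_vec_uminus)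
  qed (rule *)
qed

text \<open>The exchange condition. Follow \<open>a\<close> through the word from its right end. At
  the letter \<open>b\<close> where it leaves \<open>P\<close>, its image is \<open>b\<close> itself
  by \<open>simple_reflection_positive\<close>, so the reflection in \<open>a\<close>, moved to that
  place, cancels this letter.\<close>

lemma deletion:
  assumes "set ws \<subseteq> D" "a \<in> D" "refl_word ws a \<notin> P"
  shows "\<exists>vs. set vs \<subseteq> D \<and> Suc (length vs) = length ws \<and>
    (\<forall>x\<in>V. refl_word ws (refl_vec a x) = refl_word vs x)"
  using assms(1,3)
proof (induction ws)
  case Nil
  then show ?case using simpleD[OF assms(2)] by auto
next
  case (Cons b ws)
  show ?case
  proof (cases "refl_word ws a \<in> P")
    case False
    with Cons obtain vs where "set vs \<subseteq> D" "Suc (length vs) = length ws"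
      "\<forall>x\<in>V. refl_word ws (refl_vec a x) = refl_word vs x"
      by auto
    then show ?thesis using Cons.prems by (intro exI[of _ "b # vs"]) auto
  next
    case True
    then have eq: "refl_word ws a = b"
      using simple_reflection_positive[of b "refl_word ws a"] Cons.prems by auto
    note wsD = simple_wordD[of ws]
    have "refl_word (b # ws) (refl_vec a x) = refl_word ws x" if "x \<in> V" for x
      using refl_word_refl_vec[OF wsD, of a x] Cons.prems that eq simpleD assms(2) wsD(1)
      by (auto simp: refl_vec_involutive)
    then show ?thesis using Cons.prems by (intro exI[of _ ws]) auto
  qed
qed

text \<open>All positive roots are required because the next induction pairs \<open>y\<close> with
  images of simple roots; \<open>chamber_if_simple\<close> reduces membership to simple
  roots.\<close>

definition chamber :: "real vec set" where
  "chamber = {x \<in> V. \<forall>u\<in>P. 0 \<le> u \<bullet> x}"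

text \<open>Induction on the length, removing the last letter \<open>a\<close>. If the rest of the
  word keeps \<open>a\<close> positive, removal adds
  \<open>2 * (a \<bullet> x) * (refl_word vs a \<bullet> y)\<close>, which is nonnegative in the
  chamber. Otherwise \<open>deletion\<close> supplies a shorter word for the same element.\<close>

lemma chamber_scalar_prod_le:
  assumes "x \<in> chamber" "y \<in> chamber" "set ws \<subseteq> D"
  shows "refl_word ws x \<bullet> y \<le> x \<bullet> y"
  using assms(3)
proof (induction "length ws" arbitrary: ws rule: less_induct)
  case less
  have xy: "x \<in> V" "y \<in> V" using assms by (auto simp: chamber_def)
  show ?case
  proof (cases ws rule: rev_cases)
    case Nil
    then show ?thesis by simp
  next
    case (snoc vs a)
    have a: "a \<in> D" "a \<in> V" "set vs \<subseteq> D" using snoc less.prems simpleD by auto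
    have ws_eq: "refl_word ws x = refl_word vs (refl_vec a x)"
      by (simp add: snoc refl_word_append)
    show ?thesis
    proof (cases "refl_word vs a \<in> P")
      case False
      then obtain us where us: "set us \<subseteq> D" "Suc (length us) = length vs"
        "refl_word vs (refl_vec a x) = refl_word us x"
        using deletion[OF a(3,1)] xy by blast
      have "refl_word us x \<bullet> y \<le> x \<bullet> y"
        using us snoc by (intro less.hyps) auto
      then show ?thesis by (simp add: ws_eq us)
    next
      case True
      have "refl_word ws x \<bullet> y = refl_word vs x \<bullet> y - 2 * (a \<bullet> x) * (refl_word vs a \<bullet> y)"
        using simple_wordD[OF a(3)] a xy
        by (simp add: ws_eq refl_vec_def[of a x] refl_word_linear scalar_prod_bilinear)
      moreover have "0 \<le> a \<bullet> x" "0 \<le> refl_word vs a \<bullet> y"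
        using assms(1,2) True simple_positive a(1) by (auto simp: chamber_def)
      ultimately have "refl_word ws x \<bullet> y \<le> refl_word vs x \<bullet> y" by simp
      also have "\<dots> \<le> x \<bullet> y"
        using snoc a by (intro less.hyps) auto
      finally show ?thesis .
    qed
  qed
qed

lemma exists_simple_dual:
  assumes "a \<in> D"
  shows "\<exists>c. \<forall>b\<in>D. comb D c \<bullet> b = (if b = a then 1 else 0)"
  using dual_coefficients[OF finite_simple simple_carrier, of "\<lambda>b. if b = a then 1 else 0"]
    simple_independent by blast

text \<open>Along a word, each letter either fixes \<open>x\<close> or moves it by twice a root. Hence the walk
  through the orbit has bounded steps, and it has to visit many points before it leaves the
  half space around \<open>x\<close>.\<close>

lemma norm_le_card_orbit:
  assumes x: "x \<in> V" "\<And>a. a \<in> D \<Longrightarrow> a \<bullet> x \<in> {0, 1}"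
    and X: "finite X" "\<And>vs. set vs \<subseteq> D \<Longrightarrow> refl_word vs x \<in> X"
    and ws: "set ws \<subseteq> D" "x \<bullet> refl_word ws x \<le> 0"
  shows "x \<bullet> x \<le> (2 * real (card X))\<^sup>2"
proof -
  define s where "s = sqrt (x \<bullet> x)"
  have s: "0 \<le> s" "x \<bullet> x = s\<^sup>2" by (auto simp: s_def scalar_prod_self_nonneg)
  \<comment> \<open>Prefixes instead of suffixes: the next letter then acts directly on
    \<open>x\<close>, so the size of the step is governed by
    \<open>a \<bullet> x \<in> {0, 1}\<close> and not by a product with some other orbit
    point.\<close>
  define h where "h j = x \<bullet> refl_word (take j ws) x" for j
  have step: "\<bar>h (Suc j) - h j\<bar> \<le> 2 * s" if j: "j < length ws" for j
  proof -
    define a where "a = ws ! j"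
    define y where "y = refl_word (take j ws) a"
    have a: "a \<in> D" using ws(1) j by (auto simp: a_def)
    have tk: "set (take j ws) \<subseteq> D" using ws(1) by (meson order_trans set_take_subset)
    note tkD = simple_wordD[OF tk]
    have y: "y \<in> V" "y \<bullet> y = 1"
      using tkD a simpleD by (auto simp: y_def refl_word_isometry)
    have "refl_word (take (Suc j) ws) x = refl_word (take j ws) (refl_vec a x)"
      using j by (simp add: take_Suc_conv_app_nth refl_word_append a_def)
    also have "\<dots> = refl_word (take j ws) x - (2 * (a \<bullet> x)) \<cdot>\<^sub>v y"
      using tkD a simpleD x by (simp add: refl_vec_def refl_word_linear y_def)
    finally have "h (Suc j) - h j = - 2 * (a \<bullet> x) * (x \<bullet> y)"
      using x y tkD by (simp add: h_def scalar_prod_bilinear)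
    moreover have "\<bar>x \<bullet> y\<bar> \<le> s"
      using cauchy_schwarz[OF x(1) y(1)] y s by (metis abs_le_square_iff abs_of_nonneg mult.right_neutral)
    ultimately show ?thesis using x(2)[OF a] s(1) by (auto simp: abs_mult)
  qed
  have "h ` {..length ws} \<subseteq> (\<lambda>p. x \<bullet> p) ` X"
    using ws(1) by (auto simp: h_def intro!: imageI X(2) dest: in_set_takeD)
  then have "card (h ` {..length ws}) \<le> card X"
    using X(1) by (meson card_image_le card_mono finite_imageI order_trans)
  then have card: "real (card (h ` {..length ws})) - 1 \<le> real (card X)" by linarith
  \<comment> \<open>The empty prefix gives \<open>h 0 = s * s\<close>, and the full word ends at a
    nonpositive value.\<close>
  have "s\<^sup>2 \<le> h 0 - h (length ws)"
    using ws(2) s by (simp add: h_def)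
  also have "\<dots> \<le> 2 * s * (real (card (h ` {..length ws})) - 1)"
    by (rule order_trans[OF abs_ge_self], rule walk_diameter) (auto intro: step)
  also have "\<dots> \<le> 2 * s * real (card X)"
    using card s by (intro mult_left_mono) auto
  finally have "s * s \<le> s * (2 * real (card X))" by (simp add: power2_eq_square algebra_simps)
  then have "s \<le> 2 * real (card X)"
    using s(1) by (cases "s = 0") auto
  then show ?thesis unfolding s(2) using s(1) by (rule power_mono)
qed

end

section \<open>Reflection matrices and unit roots\<close>

context dimension
begin

lemma mat_eq_if_mult_vec_eq:
  fixes A B :: "real mat"
  assumes "A \<in> carrier_mat d d" "B \<in> carrier_mat d d" "\<And>x. x \<in> V \<Longrightarrow> A *\<^sub>v x = B *\<^sub>v x"
  shows "A = B"
proof (rule eq_matI)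
  fix i j assume "i < dim_row B" "j < dim_col B"
  then have ij: "i < d" "j < d" using assms by auto
  have "(A *\<^sub>v unit_vec d j) $ i = (B *\<^sub>v unit_vec d j) $ i"
    using assms(3)[of "unit_vec d j"] by simp
  then show "A $$ (i, j) = B $$ (i, j)"
    using ij assms(1,2) by (simp add: row_def)
qed (use assms in auto)

lemma reflection_mult_vec:
  assumes "u \<in> V" "x \<in> V"
  shows "reflection u *\<^sub>v x = x - (2 / (u \<bullet> u) * (u \<bullet> x)) \<cdot>\<^sub>v u"
proof (rule eq_vecI)
  define c where "c = 2 / (u \<bullet> u)"
  fix i assume "i < dim_vec (x - (2 / (u \<bullet> u) * (u \<bullet> x)) \<cdot>\<^sub>v u)"
  then have i: "i < d" using assms by auto
  have "(reflection u *\<^sub>v x) $ i =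
      (\<Sum>j = 0..<d. ((if i = j then 1 else 0) - c * (u $ i * u $ j)) * x $ j)"
    using i assms by (simp add: c_def reflection_eq[OF assms(1)] scalar_prod_def)
  also have "\<dots> = (\<Sum>j = 0..<d. (if i = j then x $ j else 0) - c * u $ i * (u $ j * x $ j))"
    by (intro sum.cong) (auto simp: algebra_simps)
  also have "\<dots> = x $ i - c * u $ i * (u \<bullet> x)"
    using i assms by (simp add: sum_subtractf sum_distrib_left scalar_prod_def)
  finally show "(reflection u *\<^sub>v x) $ i = (x - (2 / (u \<bullet> u) * (u \<bullet> x)) \<cdot>\<^sub>v u) $ i"
    using i assms by (simp add: c_def)
qed (use assms in \<open>auto simp: reflection_eq\<close>)

lemma reflection_unit_mult_vec:
  "u \<in> V \<Longrightarrow> u \<bullet> u = 1 \<Longrightarrow> x \<in> V \<Longrightarrow> reflection u *\<^sub>v x = refl_vec u x"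
  by (simp add: reflection_mult_vec refl_vec_def)

lemma reflection_carrier: "u \<in> V \<Longrightarrow> reflection u \<in> carrier_mat d d"
  by (simp add: reflection_eq)

text \<open>Rescaling brings arbitrary reflections to unit vectors, for which
  \<open>refl_vec\<close> describes the action.\<close>

lemma reflection_normalize:
  assumes "u \<in> V" "u \<noteq> 0\<^sub>v d"
  shows "\<exists>a\<in>V. a \<bullet> a = 1 \<and> reflection a = reflection u"
proof -
  define k where "k = 1 / sqrt (u \<bullet> u)"
  have uu: "u \<bullet> u > 0"
    using assms scalar_prod_self_eq_0 scalar_prod_self_nonneg[of u] by (metis less_eq_real_def)
  then have kk: "k * k = 1 / (u \<bullet> u)" by (simp add: k_def)
  have a: "k \<cdot>\<^sub>v u \<in> V" "(k \<cdot>\<^sub>v u) \<bullet> (k \<cdot>\<^sub>v u) = 1"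
    using assms uu kk by (auto simp: scalar_prod_bilinear mult.assoc[symmetric])
  have "reflection (k \<cdot>\<^sub>v u) *\<^sub>v x = reflection u *\<^sub>v x" if "x \<in> V" for x
  proof -
    have "(2 * (k * (u \<bullet> x))) * k = 2 / (u \<bullet> u) * (u \<bullet> x)"
    proof -
      have "(2 * (k * (u \<bullet> x))) * k = (k * k) * (2 * (u \<bullet> x))"
        by (simp only: mult_ac)
      then show ?thesis by (simp add: kk)
    qed
    then show ?thesis
      using a assms that
      by (simp add: reflection_unit_mult_vec refl_vec_def reflection_mult_vec scalar_prod_bilinear
          smult_smult_assoc)
  qed
  then have "reflection (k \<cdot>\<^sub>v u) = reflection u"
    using a(1) assms(1) by (intro mat_eq_if_mult_vec_eq reflection_carrier)
  then show ?thesis using a by blast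
qed

text \<open>The normalised root system: it covers all reflections in \<open>G\<close>, not just a
  generating set, and is therefore closed under reflection.\<close>

definition unit_roots :: "real mat set \<Rightarrow> real vec set" where
  "unit_roots G = {u \<in> V. u \<bullet> u = 1 \<and> reflection u \<in> G}"

lemma reflection_eq_imp:
  assumes "a \<in> V" "a \<bullet> a = 1" "b \<in> V" "b \<bullet> b = 1" "reflection a = reflection b"
  shows "b = a \<or> b = - a"
  using assms refl_vec_eq_imp[of a b] reflection_unit_mult_vec[of a b] reflection_unit_mult_vec[of b b]
  by simp

text \<open>Each reflection in \<open>G\<close> comes from at most two opposite unit
  vectors.\<close>

lemma finite_unit_roots:
  assumes "finite G"
  shows "finite (unit_roots G)"
proof -
  have "finite {u \<in> V. u \<bullet> u = 1 \<and> reflection u = g}" (is "finite ?A") for g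
  proof (cases "?A = {}")
    case False
    then obtain a where "a \<in> ?A" by blast
    then have "?A \<subseteq> {a, - a}" using reflection_eq_imp by blast
    then show ?thesis by (rule finite_subset) simp
  next
    case True
    then show ?thesis by (simp only: finite.emptyI)
  qed
  then have "finite (\<Union>g\<in>G. {u \<in> V. u \<bullet> u = 1 \<and> reflection u = g})"
    using assms by blast
  moreover have "unit_roots G \<subseteq> (\<Union>g\<in>G. {u \<in> V. u \<bullet> u = 1 \<and> reflection u = g})"
    by (auto simp: unit_roots_def)
  ultimately show ?thesis by (rule rev_finite_subset)
qed

end

subsection \<open>Finite reflection groups and their orbits\<close>

locale finite_reflection_group = dimension +
  fixes G :: "real mat set"
  assumes finite_group: "finite G"
    and reflection_group: "reflection_group d G"
begin

lemma group_subgroup: "subgroup G (orthogonal_group d)"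
  using reflection_group by (simp add: reflection_group_def)

lemma group_carrier: "g \<in> G \<Longrightarrow> g \<in> carrier_mat d d"
  and group_orthogonal: "g \<in> G \<Longrightarrow> transpose_mat g * g = 1\<^sub>m d"
  using subgroup.subset[OF group_subgroup] by (auto simp: orthogonal_group_def)

lemma group_mult: "g \<in> G \<Longrightarrow> h \<in> G \<Longrightarrow> g * h \<in> G"
  using subgroup.m_closed[OF group_subgroup] by (simp add: orthogonal_group_def)

lemma group_one: "1\<^sub>m d \<in> G"
  using subgroup.one_closed[OF group_subgroup] by (simp add: orthogonal_group_def)

lemma act_carrier [simp]: "g \<in> G \<Longrightarrow> x \<in> V \<Longrightarrow> g *\<^sub>v x \<in> V"
  by (rule mult_mat_vec_carrier[OF group_carrier])

lemma act_mult: "g \<in> G \<Longrightarrow> h \<in> G \<Longrightarrow> x \<in> V \<Longrightarrow> (g * h) *\<^sub>v x = g *\<^sub>v (h *\<^sub>v x)"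
  using group_carrier by (intro assoc_mult_mat_vec)

lemma act_one: "x \<in> V \<Longrightarrow> 1\<^sub>m d *\<^sub>v x = x"
  by simp

lemma group_inverse:
  assumes "g \<in> G"
  shows "\<exists>h\<in>G. h * g = 1\<^sub>m d \<and> g * h = 1\<^sub>m d"
proof -
  interpret O: group "orthogonal_group d" by (rule group_orthogonal_group)
  have g: "g \<in> carrier (orthogonal_group d)" using assms subgroup.subset[OF group_subgroup] by auto
  have "inv\<^bsub>orthogonal_group d\<^esub> g \<in> G" by (rule subgroup.m_inv_closed[OF group_subgroup assms])
  then show ?thesis
    using O.l_inv[OF g] O.r_inv[OF g] by (auto simp: orthogonal_group_def)
qed

lemma act_inverse:
  assumes "g \<in> G"
  shows "\<exists>h\<in>G. \<forall>x\<in>V. h *\<^sub>v (g *\<^sub>v x) = x \<and> g *\<^sub>v (h *\<^sub>v x) = x"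
  using group_inverse[OF assms] assms by (metis act_mult act_one)

lemma act_isometry:
  assumes "g \<in> G" "x \<in> V" "y \<in> V"
  shows "(g *\<^sub>v x) \<bullet> (g *\<^sub>v y) = x \<bullet> y"
proof -
  note g = group_carrier[OF assms(1)]
  have "x \<bullet> y = x \<bullet> ((transpose_mat g * g) *\<^sub>v y)"
    using group_orthogonal[OF assms(1)] assms by simp
  also have "\<dots> = x \<bullet> (transpose_mat g *\<^sub>v (g *\<^sub>v y))"
    using g assms by (subst assoc_mult_mat_vec) auto
  also have "\<dots> = (transpose_mat g *\<^sub>v (g *\<^sub>v y)) \<bullet> x"
    using g assms by (intro scalar_prod_comm) auto
  also have "\<dots> = (g *\<^sub>v y) \<bullet> (g *\<^sub>v x)"
    using g assms by (intro transpose_vec_mult_scalar) auto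
  also have "\<dots> = (g *\<^sub>v x) \<bullet> (g *\<^sub>v y)"
    using assms by (intro scalar_prod_comm) auto
  finally show ?thesis by simp
qed

lemma unit_rootsD:
  assumes "a \<in> unit_roots G"
  shows "a \<in> V" "a \<bullet> a = 1" "reflection a \<in> G" "x \<in> V \<Longrightarrow> reflection a *\<^sub>v x = refl_vec a x"
  using assms by (auto simp: unit_roots_def reflection_unit_mult_vec)

text \<open>Conjugating the reflection in \<open>b\<close> by the one in \<open>a\<close> gives the
  reflection in \<open>refl_vec a b\<close>.\<close>

lemma unit_roots_closed:
  assumes "a \<in> unit_roots G" "b \<in> unit_roots G"
  shows "refl_vec a b \<in> unit_roots G"
proof -
  note a = unit_rootsD[OF assms(1)] and b = unit_rootsD[OF assms(2)]
  define c where "c = refl_vec a b"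
  have c: "c \<in> V" "c \<bullet> c = 1" using a b by (auto simp: c_def scalar_prod_refl_refl)
  let ?g = "reflection a * (reflection b * reflection a)"
  have g: "?g \<in> G" using a b by (intro group_mult)
  have "reflection c *\<^sub>v x = ?g *\<^sub>v x" if x: "x \<in> V" for x
  proof -
    have "?g *\<^sub>v x = refl_vec a (refl_vec b (refl_vec a x))"
      using a b x by (simp add: act_mult group_mult)
    also have "\<dots> = refl_vec c (refl_vec a (refl_vec a x))"
      using refl_word_refl_vec[of "[a]" b "refl_vec a x"] a b x by (simp add: c_def)
    also have "\<dots> = reflection c *\<^sub>v x"
      using a c x by (simp add: refl_vec_involutive reflection_unit_mult_vec)
    finally show ?thesis by simp
  qed
  then have "reflection c = ?g"
    using c g by (intro mat_eq_if_mult_vec_eq reflection_carrier group_carrier)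
  then show ?thesis using c g by (simp add: unit_roots_def c_def)
qed

lemma finite_orbit: "finite (orbit_of G x)"
proof -
  have "orbit_of G x = (\<lambda>g. g *\<^sub>v x) ` G" by (auto simp: orbit_of_def)
  then show ?thesis using finite_group by simp
qed

lemma orbit_self: "x \<in> V \<Longrightarrow> x \<in> orbit_of G x"
  using group_one by (auto simp: orbit_of_def intro!: exI[of _ "1\<^sub>m d"])

lemma orbit_carrier: "x \<in> V \<Longrightarrow> orbit_of G x \<subseteq> V"
  by (auto simp: orbit_of_def)

lemma act_orbit: "g \<in> G \<Longrightarrow> x \<in> V \<Longrightarrow> p \<in> orbit_of G x \<Longrightarrow> g *\<^sub>v p \<in> orbit_of G x"
  by (auto simp: orbit_of_def act_mult[symmetric] intro!: group_mult)

lemma orbit_eq: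
  assumes "x \<in> V" "p \<in> orbit_of G x"
  shows "orbit_of G p = orbit_of G x"
proof
  obtain g where g: "g \<in> G" "p = g *\<^sub>v x" using assms by (auto simp: orbit_of_def)
  obtain h where h: "h \<in> G" "h *\<^sub>v p = x" using act_inverse[OF g(1)] g assms by auto
  show "orbit_of G p \<subseteq> orbit_of G x"
    using act_orbit assms by (auto simp: orbit_of_def[of G p])
  have pV: "p \<in> V" using orbit_carrier assms by auto
  have "x \<in> orbit_of G p" using h by (auto simp: orbit_of_def)
  then show "orbit_of G x \<subseteq> orbit_of G p"
    using act_orbit pV by (auto simp: orbit_of_def[of G x])
qed

text \<open>Coset representatives \<open>rep p\<close> times stabilizer elements are distinct
  elements of \<open>G\<close>: the product sends \<open>x\<close> to \<open>p\<close>, and then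
  \<open>rep p\<close> cancels.\<close>

lemma card_orbit_stabilizer_le:
  assumes x: "x \<in> V"
  shows "card (orbit_of G x) * card {g \<in> G. g *\<^sub>v x = x} \<le> card G"
proof -
  let ?S = "{g \<in> G. g *\<^sub>v x = x}"
  have "\<forall>p\<in>orbit_of G x. \<exists>g\<in>G. g *\<^sub>v x = p" by (auto simp: orbit_of_def)
  then obtain rep where rep: "\<And>p. p \<in> orbit_of G x \<Longrightarrow> rep p \<in> G \<and> rep p *\<^sub>v x = p"
    by metis
  have "inj_on (\<lambda>(p, q). rep p * q) (orbit_of G x \<times> ?S)"
  proof (rule inj_onI, clarify)
    fix p q p' q' assume A: "p \<in> orbit_of G x" "q \<in> G" "q *\<^sub>v x = x"
      "p' \<in> orbit_of G x" "q' \<in> G" "q' *\<^sub>v x = x" "rep p * q = rep p' * q'"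
    have "p = (rep p * q) *\<^sub>v x" using A(1-3) rep x by (simp add: act_mult)
    also have "\<dots> = (rep p' * q') *\<^sub>v x" by (simp only: A(7))
    also have "\<dots> = p'" using A(4-6) rep x by (simp add: act_mult)
    finally have pp: "p = p'" .
    obtain h where h: "h \<in> G" "h * rep p = 1\<^sub>m d" using group_inverse rep A by blast
    have "h * (rep p * r) = r" if "r \<in> G" for r
    proof -
      have "h * (rep p * r) = (h * rep p) * r"
        using h rep[OF A(1)] that group_carrier by (intro assoc_mult_mat[symmetric]) auto
      then show ?thesis using h group_carrier[OF that] by simp
    qed
    then have "q = q'" using A pp by metis
    with pp show "p = p' \<and> q = q'" by simp
  qed
  moreover have "(\<lambda>(p, q). rep p * q) ` (orbit_of G x \<times> ?S) \<subseteq> G"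
    using rep by (auto intro: group_mult)
  ultimately have "card (orbit_of G x \<times> ?S) \<le> card G"
    using finite_group by (rule card_inj_on_le)
  then show ?thesis by (simp add: card_cartesian_product)
qed

end

subsection \<open>The fundamental chamber\<close>

locale reflection_group_chamber = simple_system d R D \<rho> + finite_reflection_group d G
  for d R D \<rho> G +
  assumes roots_eq: "R = unit_roots G"
begin

lemma rootG: "a \<in> R \<Longrightarrow> reflection a \<in> G"
    "a \<in> R \<Longrightarrow> x \<in> V \<Longrightarrow> reflection a *\<^sub>v x = refl_vec a x"
  using unit_rootsD by (auto simp: roots_eq)

lemma simple_word_in_group:
  "set ws \<subseteq> D \<Longrightarrow> \<exists>g\<in>G. \<forall>x\<in>V. g *\<^sub>v x = refl_word ws x"
proof (induction ws)
  case Nil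
  then show ?case using group_one by (intro bexI[of _ "1\<^sub>m d"]) auto
next
  case (Cons a ws)
  then obtain g where g: "g \<in> G" "\<forall>x\<in>V. g *\<^sub>v x = refl_word ws x" by auto
  have a: "a \<in> R" using Cons.prems simpleD by auto
  have "(reflection a * g) *\<^sub>v x = refl_word (a # ws) x" if "x \<in> V" for x
  proof -
    have "refl_word ws x \<in> V" using act_carrier[OF g(1) that] g(2) that by simp
    then show ?thesis using g a that by (simp add: act_mult rootG)
  qed
  then show ?case using g a by (intro bexI[of _ "reflection a * g"]) (auto intro: group_mult rootG)
qed

text \<open>Generation by reflections enters here. Each generator is the reflection in a root, hence
  a word, and is its own inverse; products concatenate words.\<close>

lemma group_simple_word:
  assumes "g \<in> G"
  shows "\<exists>ws. set ws \<subseteq> D \<and> (\<forall>x\<in>V. g *\<^sub>v x = refl_word ws x)"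
proof -
  obtain S where S: "S \<subseteq> reflections d" "G = generate (orthogonal_group d) S"
    using reflection_group by (auto simp: reflection_group_def)
  interpret O: group "orthogonal_group d" by (rule group_orthogonal_group)
  have refl: "\<exists>ws. set ws \<subseteq> D \<and> (\<forall>x\<in>V. s *\<^sub>v x = refl_word ws x)"
    and refl_inv: "inv\<^bsub>orthogonal_group d\<^esub> s = s" if s: "s \<in> S" for s
  proof -
    have "s \<in> G" using S s generate.incl by auto
    obtain u where "u \<in> V" "u \<noteq> 0\<^sub>v d" "s = reflection u"
      using s S by (auto simp: reflections_def)
    then obtain a where a: "a \<in> V" "a \<bullet> a = 1" "s = reflection a"
      using reflection_normalize by metis
    then have aR: "a \<in> R" using \<open>s \<in> G\<close> by (auto simp: roots_eq unit_roots_def)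
    then show "\<exists>ws. set ws \<subseteq> D \<and> (\<forall>x\<in>V. s *\<^sub>v x = refl_word ws x)"
      using reflection_simple_word[OF aR] rootG(2)[OF aR] a(3) by auto
    have "s * s = 1\<^sub>m d"
    proof (rule mat_eq_if_mult_vec_eq)
      fix x assume "x \<in> V"
      then show "(s * s) *\<^sub>v x = 1\<^sub>m d *\<^sub>v x"
        using \<open>s \<in> G\<close> a aR by (simp add: act_mult rootG refl_vec_involutive)
    qed (use group_carrier[OF \<open>s \<in> G\<close>] in auto)
    moreover have "s \<in> carrier (orthogonal_group d)"
      using S s reflections_orthogonal by auto
    ultimately show "inv\<^bsub>orthogonal_group d\<^esub> s = s"
      by (intro O.inv_equality) (auto simp: orthogonal_group_def)
  qed
  have "g \<in> generate (orthogonal_group d) S" using assms S by simp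
  then show ?thesis
  proof (induction rule: generate.induct)
    case one
    then show ?case by (intro exI[of _ "[]"]) (simp add: orthogonal_group_def)
  next
    case (incl h)
    then show ?case by (rule refl)
  next
    case (inv h)
    then show ?case using refl refl_inv by simp
  next
    case (eng g h)
    then have gh: "g \<in> G" "h \<in> G" using S by auto
    obtain vs ws where vs: "set vs \<subseteq> D" "\<forall>x\<in>V. g *\<^sub>v x = refl_word vs x"
      and ws: "set ws \<subseteq> D" "\<forall>x\<in>V. h *\<^sub>v x = refl_word ws x"
      using eng.IH by auto
    have "(g * h) *\<^sub>v x = refl_word (vs @ ws) x" if "x \<in> V" for x
    proof -
      have "(g * h) *\<^sub>v x = g *\<^sub>v (h *\<^sub>v x)" by (rule act_mult[OF gh that])
      also have "\<dots> = refl_word vs (h *\<^sub>v x)" using vs(2) act_carrier[OF gh(2) that] by blast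
      finally show ?thesis using ws(2) that by (simp add: refl_word_append)
    qed
    then show ?case using vs ws
      by (intro exI[of _ "vs @ ws"]) (simp add: orthogonal_group_def)
  qed
qed

lemma chamber_carrier: "x \<in> chamber \<Longrightarrow> x \<in> V"
  by (simp add: chamber_def)

text \<open>An orbit point maximising \<open>\<rho> \<bullet> p\<close> lies in the chamber:
  reflecting it in a positive root with \<open>u \<bullet> p < 0\<close> would increase the
  value.\<close>

lemma orbit_meets_chamber:
  assumes x: "x \<in> V"
  shows "\<exists>p\<in>chamber. orbit_of G p = orbit_of G x"
proof -
  have "finite (orbit_of G x)" "orbit_of G x \<noteq> {}"
    using finite_orbit orbit_self[OF x] by auto
  then obtain p where p: "p \<in> orbit_of G x" and max: "\<And>q. q \<in> orbit_of G x \<Longrightarrow> - (\<rho> \<bullet> p) \<le> - (\<rho> \<bullet> q)"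
    using arg_min_if_finite(1)[of "orbit_of G x" "\<lambda>p. - (\<rho> \<bullet> p)"]
      arg_min_least[of "orbit_of G x" _ "\<lambda>p. - (\<rho> \<bullet> p)"]
    by blast
  have pV: "p \<in> V" using p orbit_carrier[OF x] by auto
  have "0 \<le> u \<bullet> p" if u: "u \<in> P" for u
  proof -
    have "refl_vec u p \<in> orbit_of G x"
      using act_orbit[OF rootG(1) x p, of u] rootG(2)[of u p] u pV by simp
    then have "\<rho> \<bullet> refl_vec u p \<le> \<rho> \<bullet> p" using max by fastforce
    moreover have "\<rho> \<bullet> refl_vec u p = \<rho> \<bullet> p - 2 * (u \<bullet> p) * (\<rho> \<bullet> u)"
      using pV u rootD rho_carrier by (simp add: refl_vec_def scalar_prod_bilinear)
    ultimately have "0 \<le> (u \<bullet> p) * (\<rho> \<bullet> u)" by (simp add: mult.commute)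
    then show ?thesis using u by (simp add: zero_le_mult_iff)
  qed
  then show ?thesis
    using pV orbit_eq[OF x p] by (intro bexI[of _ p]) (auto simp: chamber_def)
qed

lemma orbits_scalar_prod_le:
  assumes "x \<in> chamber" "y \<in> chamber" "p \<in> orbit_of G x" "q \<in> orbit_of G y"
  shows "p \<bullet> q \<le> x \<bullet> y"
proof -
  note V = chamber_carrier[OF assms(1)] chamber_carrier[OF assms(2)]
  obtain g h where g: "g \<in> G" "p = g *\<^sub>v x" and h: "h \<in> G" "q = h *\<^sub>v y"
    using assms by (auto simp: orbit_of_def)
  obtain k where k: "k \<in> G" "\<forall>x\<in>V. k *\<^sub>v (h *\<^sub>v x) = x" using act_inverse[OF h(1)] by blast
  have "p \<bullet> q = (k *\<^sub>v p) \<bullet> (k *\<^sub>v q)"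
    using g h k V by (subst act_isometry) auto
  also have "k *\<^sub>v q = y" using k h V by simp
  also have "k *\<^sub>v p = (k * g) *\<^sub>v x" using k g V by (simp add: act_mult)
  finally have pq: "p \<bullet> q = ((k * g) *\<^sub>v x) \<bullet> y" .
  obtain ws where "set ws \<subseteq> D" "\<forall>x\<in>V. (k * g) *\<^sub>v x = refl_word ws x"
    using group_simple_word[OF group_mult[OF k(1) g(1)]] by blast
  then show ?thesis using chamber_scalar_prod_le[OF assms(1,2)] pq V by simp
qed

lemma max_filter_chamber:
  assumes "x \<in> chamber" "y \<in> chamber"
  shows "max_filter (orbit_of G x) (orbit_of G y) = x \<bullet> y"
  unfolding max_filter_def
proof (rule Max_eqI)
  have "{p \<bullet> q |p q. p \<in> orbit_of G x \<and> q \<in> orbit_of G y} =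
      (\<lambda>(p, q). p \<bullet> q) ` (orbit_of G x \<times> orbit_of G y)" by auto
  then show "finite {p \<bullet> q |p q. p \<in> orbit_of G x \<and> q \<in> orbit_of G y}"
    using finite_orbit by simp
  show "x \<bullet> y \<in> {p \<bullet> q |p q. p \<in> orbit_of G x \<and> q \<in> orbit_of G y}"
    using orbit_self[OF chamber_carrier] assms by blast
next
  fix r assume "r \<in> {p \<bullet> q |p q. p \<in> orbit_of G x \<and> q \<in> orbit_of G y}"
  then show "r \<le> x \<bullet> y" using orbits_scalar_prod_le[OF assms] by blast
qed

lemma orbit_norm:
  assumes "x \<in> V" "p \<in> orbit_of G x"
  shows "p \<bullet> p = x \<bullet> x"
proof -
  obtain g where "g \<in> G" "p = g *\<^sub>v x" using assms(2) by (auto simp: orbit_of_def)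
  then show ?thesis using act_isometry assms(1) by blast
qed

text \<open>Norms are constant on orbits, so minimising the distance is the same as maximising the
  scalar product.\<close>

lemma orbit_dist_chamber:
  assumes "x \<in> chamber" "y \<in> chamber"
  shows "orbit_dist (orbit_of G x) (orbit_of G y) = vec_norm (x - y)"
  unfolding orbit_dist_def
proof (rule Min_eqI)
  have "{vec_norm (p - q) |p q. p \<in> orbit_of G x \<and> q \<in> orbit_of G y} =
      (\<lambda>(p, q). vec_norm (p - q)) ` (orbit_of G x \<times> orbit_of G y)" by auto
  then show "finite {vec_norm (p - q) |p q. p \<in> orbit_of G x \<and> q \<in> orbit_of G y}"
    using finite_orbit by simp
  show "vec_norm (x - y) \<in> {vec_norm (p - q) |p q. p \<in> orbit_of G x \<and> q \<in> orbit_of G y}"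
    using orbit_self[OF chamber_carrier] assms by blast
next
  fix r assume "r \<in> {vec_norm (p - q) |p q. p \<in> orbit_of G x \<and> q \<in> orbit_of G y}"
  then obtain p q where pq: "p \<in> orbit_of G x" "q \<in> orbit_of G y" and r: "r = vec_norm (p - q)"
    by blast
  note V = chamber_carrier[OF assms(1)] chamber_carrier[OF assms(2)]
  have pV: "p \<in> V" "q \<in> V" using pq orbit_carrier V by auto
  have norm: "(a - b) \<bullet> (a - b) = a \<bullet> a - 2 * (a \<bullet> b) + b \<bullet> b" if "a \<in> V" "b \<in> V" for a b :: "real vec"
    using that by (simp add: scalar_prod_bilinear scalar_prod_comm[of b a])
  have "(x - y) \<bullet> (x - y) \<le> (p - q) \<bullet> (p - q)"
    using V pV norm orbit_norm[OF V(1) pq(1)] orbit_norm[OF V(2) pq(2)]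
      orbits_scalar_prod_le[OF assms pq] by simp
  then show "vec_norm (x - y) \<le> r" by (simp add: r vec_norm_def)
qed

section \<open>Fundamental weights and their length\<close>

text \<open>Up to scaling, the fundamental weights. They are chosen inside the span of
  \<open>D\<close>, so that their orbits sum to zero and they do not see the part of a vector
  orthogonal to the roots.\<close>

definition weight :: "real vec \<Rightarrow> real vec" where
  "weight a = comb D (SOME c. \<forall>b\<in>D. comb D c \<bullet> b = (if b = a then 1 else 0))"

lemma weight_span: "\<exists>c. weight a = comb D c"
  by (auto simp: weight_def)

lemma weight_carrier [simp]: "weight a \<in> V"
  by (simp add: weight_def)

lemma weight_dual: "a \<in> D \<Longrightarrow> b \<in> D \<Longrightarrow> weight a \<bullet> b = (if b = a then 1 else 0)"
  using someI_ex[OF exists_simple_dual[of a]] by (simp add: weight_def)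

lemma weight_dual': "a \<in> D \<Longrightarrow> b \<in> D \<Longrightarrow> b \<bullet> weight a = (if b = a then 1 else 0)"
  using weight_dual[of a b] simpleD(2)[of b] scalar_prod_comm[of b "weight a"] by simp

lemma chamber_if_simple:
  assumes "x \<in> V" "\<And>b. b \<in> D \<Longrightarrow> 0 \<le> b \<bullet> x"
  shows "x \<in> chamber"
proof -
  have "0 \<le> u \<bullet> x" if u: "u \<in> P" for u
  proof -
    obtain c where "\<forall>b\<in>D. 0 \<le> c b" "u = comb D c" using simple_generate u by blast
    then show ?thesis
      using assms simple_carrier by (auto simp: scalar_prod_comb_left intro!: sum_nonneg mult_nonneg_nonneg)
  qed
  then show ?thesis using assms(1) by (simp add: chamber_def)
qed

lemma weight_chamber: "a \<in> D \<Longrightarrow> weight a \<in> chamber"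
  by (rule chamber_if_simple) (auto simp: weight_dual')

text \<open>Replacing \<open>g\<close> by its product with the reflection in \<open>a\<close>
  permutes \<open>G\<close> and flips every sign.\<close>

lemma sum_group_root:
  assumes a: "a \<in> R" and x: "x \<in> V"
  shows "(\<Sum>g\<in>G. a \<bullet> (g *\<^sub>v x)) = 0"
proof -
  let ?s = "reflection a"
  have ss: "?s * (?s * g) = g" if "g \<in> G" for g
    using a that rootD rootG
    by (intro mat_eq_if_mult_vec_eq) (auto intro: group_mult group_carrier simp: act_mult group_mult refl_vec_involutive)
  have "(\<Sum>g\<in>G. a \<bullet> (g *\<^sub>v x)) = (\<Sum>g\<in>G. a \<bullet> ((?s * g) *\<^sub>v x))"
    by (rule sum.reindex_bij_witness[of _ "\<lambda>g. ?s * g" "\<lambda>g. ?s * g"])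
      (use a ss in \<open>auto intro: group_mult rootG\<close>)
  also have "\<dots> = (\<Sum>g\<in>G. - (a \<bullet> (g *\<^sub>v x)))"
    using a x rootD[OF a] rootG[OF a]
    by (intro sum.cong) (auto simp: act_mult refl_vec_def scalar_prod_bilinear)
  finally show ?thesis by (simp add: sum_negf)
qed

text \<open>By \<open>sum_group_root\<close> the products with \<open>x\<close> sum to zero over
  \<open>G\<close>, so they cannot all be positive. This supplies the endpoint of the walk in
  \<open>norm_le_card_orbit\<close>.\<close>

lemma exists_obtuse_image:
  assumes x: "x = comb D c"
  shows "\<exists>g\<in>G. x \<bullet> (g *\<^sub>v x) \<le> 0"
proof (rule ccontr)
  have xV: "x \<in> V" using x by simp
  assume "\<not> ?thesis"
  then have "0 < (\<Sum>g\<in>G. x \<bullet> (g *\<^sub>v x))"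
    using finite_group group_one by (intro sum_pos) auto
  also have "(\<Sum>g\<in>G. x \<bullet> (g *\<^sub>v x)) = (\<Sum>g\<in>G. \<Sum>a\<in>D. c a * (a \<bullet> (g *\<^sub>v x)))"
    using xV simple_carrier by (intro sum.cong) (auto simp: x scalar_prod_comb_left)
  also have "\<dots> = (\<Sum>a\<in>D. c a * (\<Sum>g\<in>G. a \<bullet> (g *\<^sub>v x)))"
    by (subst sum.swap) (simp add: sum_distrib_left)
  also have "\<dots> = 0"
    using sum_group_root[OF _ xV] simpleD(1) by simp
  finally show False by simp
qed

lemma card_stabilizer_weight:
  assumes a: "a \<in> D"
  shows "card D \<le> card {g \<in> G. g *\<^sub>v weight a = weight a}"
proof (rule card_inj_on_le)
  \<comment> \<open>The reflection in \<open>a\<close> moves the weight, so the index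
    \<open>a\<close> is sent to the identity and no element of \<open>D\<close> is lost.\<close>
  let ?f = "\<lambda>b. if b = a then 1\<^sub>m d else reflection b"
  have not_one: "reflection b \<noteq> 1\<^sub>m d" if b: "b \<in> D" for b
  proof
    assume "reflection b = 1\<^sub>m d"
    then have "b = - b"
      using rootG(2)[of b b] simpleD[OF b] by (simp add: refl_vec_self)
    then have "b \<bullet> b = - (b \<bullet> b)" using simpleD[OF b] by (metis scalar_prod_bilinear(7))
    then show False using simpleD[OF b] by simp
  qed
  have inj: "b = b'" if b: "b \<in> D" "b' \<in> D" "reflection b = reflection b'" for b b'
  proof -
    have "b' = b \<or> b' = - b"
      using b simpleD by (intro reflection_eq_imp) auto
    moreover have "b' \<noteq> - b"
    proof
      assume "b' = - b"
      then have "\<rho> \<bullet> b' = - (\<rho> \<bullet> b)"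
        using simpleD[OF b(1)] rho_carrier by (simp add: scalar_prod_bilinear)
      then show False using simpleD(4)[OF b(1)] simpleD(4)[OF b(2)] by simp
    qed
    ultimately show ?thesis by simp
  qed
  show "inj_on ?f D"
    using not_one not_one[symmetric] inj by (auto simp: inj_on_def)
  have "refl_vec b (weight a) = weight a" if "b \<in> D" "b \<noteq> a" for b
    using weight_dual'[OF a that(1)] that simpleD(2)[OF that(1)]
    by (simp add: refl_vec_def smult_vec_zero)
  then show "?f ` D \<subseteq> {g \<in> G. g *\<^sub>v weight a = weight a}"
    using group_one rootG simpleD by auto
qed (use finite_group in simp)

lemma norm_weight_le:
  assumes a: "a \<in> D"
  shows "weight a \<bullet> weight a \<le> (2 * (real (card G) / real (card D)))\<^sup>2"
proof -
  let ?x = "weight a" and ?O = "orbit_of G (weight a)"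
  obtain c where "?x = comb D c" using weight_span by blast
  then obtain g where g: "g \<in> G" "?x \<bullet> (g *\<^sub>v ?x) \<le> 0"
    using exists_obtuse_image by blast
  then obtain ws where ws: "set ws \<subseteq> D" "?x \<bullet> refl_word ws ?x \<le> 0"
    using group_simple_word[OF g(1)] by auto
  have "refl_word vs ?x \<in> ?O" if vs: "set vs \<subseteq> D" for vs
  proof -
    obtain g where "g \<in> G" "\<forall>x\<in>V. g *\<^sub>v x = refl_word vs x"
      using simple_word_in_group[OF vs] by blast
    then show ?thesis
      using weight_carrier[of a] unfolding orbit_of_def by (intro CollectI exI[of _ g]) simp
  qed
  then have "?x \<bullet> ?x \<le> (2 * real (card ?O))\<^sup>2"
    using ws a weight_dual' finite_orbit by (intro norm_le_card_orbit[of _ _ ws]) auto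
  also have "\<dots> \<le> (2 * (real (card G) / real (card D)))\<^sup>2"
  proof -
    have "card ?O * card D \<le> card G"
      using card_orbit_stabilizer_le[of ?x] mult_le_mono2[OF card_stabilizer_weight[OF a]]
      by (meson order_trans weight_carrier)
    then have "real (card ?O) * real (card D) \<le> real (card G)"
      by (metis of_nat_le_iff of_nat_mult)
    moreover have "0 < card D" using a finite_simple by (auto simp: card_gt_0_iff)
    ultimately have "real (card ?O) \<le> real (card G) / real (card D)"
      by (simp add: pos_le_divide_eq)
    then show ?thesis by (intro power_mono) auto
  qed
  finally show ?thesis .
qed

text \<open>The bound for each weight carries \<open>card D\<close> squared in the denominator,
  which absorbs the \<open>card D\<close> summands; without the stabilizer estimate a factor growing
  with the rank would remain.\<close>

lemma sum_norm_weight_le: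
  "(\<Sum>a\<in>D. weight a \<bullet> weight a) \<le> (2 * real (card G))\<^sup>2"
proof (cases "D = {}")
  case False
  then have D: "1 \<le> real (card D)" using finite_simple by (simp add: Suc_leI card_gt_0_iff)
  have "(\<Sum>a\<in>D. weight a \<bullet> weight a) \<le> real (card D) * (2 * (real (card G) / real (card D)))\<^sup>2"
    using sum_bounded_above[of D "\<lambda>a. weight a \<bullet> weight a", OF norm_weight_le] by simp
  also have "\<dots> = (2 * real (card G))\<^sup>2 / real (card D)"
    using D by (simp add: power2_eq_square field_simps)
  also have "\<dots> \<le> (2 * real (card G))\<^sup>2 / 1"
    using D by (intro divide_left_mono) auto
  finally show ?thesis by simp
qed simp

section \<open>Orthogonal splitting along the span of the roots\<close>

text \<open>Project \<open>z\<close> orthogonally to the span of \<open>D\<close>. Pairing with the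
  dual basis reads off the coefficients, and the weights, lying in that span, ignore the
  remainder.\<close>

lemma exists_projection:
  assumes z: "z \<in> V"
  shows "\<exists>q. z = comb D (\<lambda>a. weight a \<bullet> z) + q \<and> q \<in> V \<and> (\<forall>b\<in>D. b \<bullet> q = 0)"
proof -
  obtain c where c: "\<forall>b\<in>D. comb D c \<bullet> b = z \<bullet> b"
    using dual_coefficients[OF finite_simple simple_carrier, of "\<lambda>b. z \<bullet> b"] simple_independent
    by blast
  define q where "q = z - comb D c"
  have q: "q \<in> V" "\<forall>b\<in>D. q \<bullet> b = 0" "\<forall>b\<in>D. b \<bullet> q = 0"
  proof -
    show "q \<in> V" "\<forall>b\<in>D. q \<bullet> b = 0"
      using z c simpleD(2) by (auto simp: q_def scalar_prod_bilinear)
    then show "\<forall>b\<in>D. b \<bullet> q = 0"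
      using simpleD(2) by (auto simp: scalar_prod_comm)
  qed
  have "c a = weight a \<bullet> z" if a: "a \<in> D" for a
  proof -
    obtain k where k: "weight a = comb D k" using weight_span by blast
    have "weight a \<bullet> q = 0"
      using q simple_carrier by (simp add: k scalar_prod_comb_left)
    then have "weight a \<bullet> z = weight a \<bullet> comb D c"
      using z by (simp add: q_def scalar_prod_bilinear)
    also have "\<dots> = (\<Sum>b\<in>D. c b * (if b = a then 1 else 0))"
      using simple_carrier weight_dual[OF a] by (simp add: scalar_prod_comb_right)
    also have "\<dots> = c a"
      using finite_simple a by (simp add: if_distrib cong: if_cong)
    finally show ?thesis by simp
  qed
  then have c_eq: "comb D c = comb D (\<lambda>a. weight a \<bullet> z)" by (rule comb_cong)
  have "z = comb D c + q" using z by (auto simp: q_def vec_eq_iff lin_comb_def)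
  then show ?thesis unfolding c_eq using q by blast
qed

text \<open>The orthogonal projection to the subspace fixed by \<open>G\<close>.\<close>

definition perp_part :: "real vec \<Rightarrow> real vec" where
  "perp_part z = (SOME q. z = comb D (\<lambda>a. weight a \<bullet> z) + q \<and> q \<in> V \<and> (\<forall>b\<in>D. b \<bullet> q = 0))"

lemma perp_part:
  assumes "z \<in> V"
  shows "z = comb D (\<lambda>a. weight a \<bullet> z) + perp_part z" "perp_part z \<in> V"
    "b \<in> D \<Longrightarrow> b \<bullet> perp_part z = 0" "comb D c \<bullet> perp_part z = 0"
proof -
  from someI_ex[OF exists_projection[OF assms]]
  have *: "z = comb D (\<lambda>a. weight a \<bullet> z) + perp_part z \<and> perp_part z \<in> V \<and> (\<forall>b\<in>D. b \<bullet> perp_part z = 0)"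
    unfolding perp_part_def .
  then show "z = comb D (\<lambda>a. weight a \<bullet> z) + perp_part z" "perp_part z \<in> V"
    "b \<in> D \<Longrightarrow> b \<bullet> perp_part z = 0"
    by blast+
  show "comb D c \<bullet> perp_part z = 0"
    using * simple_carrier by (simp add: scalar_prod_comb_left)
qed

lemma perp_part_scalar_prod:
  assumes "x \<in> V" "z \<in> V"
  shows "perp_part x \<bullet> z = perp_part x \<bullet> perp_part z"
proof -
  have "perp_part x \<bullet> z = perp_part x \<bullet> (comb D (\<lambda>a. weight a \<bullet> z) + perp_part z)"
    using perp_part(1)[OF assms(2)] by simp
  also have "\<dots> = comb D (\<lambda>a. weight a \<bullet> z) \<bullet> perp_part x + perp_part x \<bullet> perp_part z"
    using perp_part(2) assms by (simp add: scalar_prod_bilinear scalar_prod_comm[of "perp_part x" "comb _ _"])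
  finally show ?thesis using perp_part(4)[OF assms(1)] by simp
qed

text \<open>Self-adjointness of the projection: both sides equal the product of the two projected
  vectors.\<close>

lemma perp_part_symmetric:
  assumes "x \<in> V" "z \<in> V"
  shows "perp_part x \<bullet> z = x \<bullet> perp_part z"
  using perp_part_scalar_prod[OF assms] perp_part_scalar_prod[OF assms(2,1)] assms perp_part(2)
  by (simp add: scalar_prod_comm)

lemma perp_part_chamber: "z \<in> V \<Longrightarrow> perp_part z \<in> chamber"
  by (rule chamber_if_simple) (auto simp: perp_part)

subsection \<open>The templates\<close>

text \<open>The projected standard basis is a Parseval frame of the fixed space, so no orthonormal
  basis of that space has to be chosen.\<close>

definition templates :: "real vec list" where
  "templates = map weight (SOME xs. set xs = D \<and> distinct xs) @
     map (\<lambda>i. perp_part (unit_vec d i)) [0..<d]"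

lemma sum_list_templates:
  "(\<Sum>t\<leftarrow>templates. f t) = (\<Sum>a\<in>D. f (weight a)) + (\<Sum>i<d. f (perp_part (unit_vec d i)))"
  for f :: "real vec \<Rightarrow> real"
proof -
  have "set (SOME xs. set xs = D \<and> distinct xs) = D \<and> distinct (SOME xs. set xs = D \<and> distinct xs)"
    using someI_ex[OF finite_distinct_list[OF finite_simple]] .
  then show ?thesis
    by (simp add: templates_def o_def sum_list_distinct_conv_sum_set atLeast0LessThan[symmetric]
        interv_sum_list_conv_sum_set_nat)
qed

lemma templates_chamber: "set templates \<subseteq> chamber"
proof -
  have "set (SOME xs. set xs = D \<and> distinct xs) = D"
    using someI_ex[OF finite_distinct_list[OF finite_simple]] by blast
  then show ?thesis
    by (auto simp: templates_def intro!: weight_chamber perp_part_chamber)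
qed

text \<open>The weights measure the root part \<open>p\<close>, and the projected basis measures
  exactly \<open>q \<bullet> q\<close>. The coefficients of \<open>p\<close> are the weight
  readings, so \<open>norm_comb_le\<close> gives the lower bound; Cauchy-Schwarz and
  \<open>sum_norm_weight_le\<close> give the upper one.\<close>

lemma templates_energy:
  assumes z: "z \<in> V"
  shows "z \<bullet> z \<le> 2 * (\<Sum>t\<leftarrow>templates. (t \<bullet> z)\<^sup>2)"
    and "(\<Sum>t\<leftarrow>templates. (t \<bullet> z)\<^sup>2) \<le> (2 * real (card G))\<^sup>2 * (z \<bullet> z)"
proof -
  define p where "p = comb D (\<lambda>a. weight a \<bullet> z)"
  define q where "q = perp_part z"
  define S where "S = (\<Sum>a\<in>D. (weight a \<bullet> z)\<^sup>2)"
  have pq: "p \<in> V" "q \<in> V" "z = p + q" "p \<bullet> q = 0"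
    using perp_part[OF z] by (auto simp: p_def q_def)
  have zz: "z \<bullet> z = p \<bullet> p + q \<bullet> q"
    using pq by (simp add: scalar_prod_bilinear scalar_prod_comm[of q p])
  \<comment> \<open>By self-adjointness the \<open>i\<close>-th reading is the coordinate
    \<open>q $ i\<close>.\<close>
  have "(\<Sum>i<d. (perp_part (unit_vec d i) \<bullet> z)\<^sup>2) = (\<Sum>i<d. q $ i * q $ i)"
    using z pq(2) by (intro sum.cong) (auto simp: perp_part_symmetric q_def power2_eq_square)
  also have "\<dots> = q \<bullet> q"
    using pq by (simp add: scalar_prod_def atLeast0LessThan)
  finally have total: "(\<Sum>t\<leftarrow>templates. (t \<bullet> z)\<^sup>2) = S + q \<bullet> q"
    by (simp add: sum_list_templates S_def)
  have "p \<bullet> p \<le> 2 * S"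
    unfolding p_def S_def by (rule norm_comb_le)
  then show "z \<bullet> z \<le> 2 * (\<Sum>t\<leftarrow>templates. (t \<bullet> z)\<^sup>2)"
    using scalar_prod_self_nonneg[of q] by (simp add: total zz)
  have "weight a \<bullet> z = weight a \<bullet> p" for a
  proof -
    obtain c where c: "weight a = comb D c" using weight_span by blast
    have "weight a \<bullet> z = weight a \<bullet> p + weight a \<bullet> q"
      using pq by (simp add: scalar_prod_bilinear)
    also have "weight a \<bullet> q = 0"
      using perp_part(4)[OF z] by (simp add: c q_def)
    finally show ?thesis by simp
  qed
  then have "S \<le> (\<Sum>a\<in>D. (weight a \<bullet> weight a) * (p \<bullet> p))"
    unfolding S_def using pq by (intro sum_mono) (auto intro: cauchy_schwarz)
  also have "\<dots> \<le> (2 * real (card G))\<^sup>2 * (p \<bullet> p)"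
    unfolding sum_distrib_right[symmetric]
    by (intro mult_right_mono sum_norm_weight_le scalar_prod_self_nonneg)
  finally have "S \<le> (2 * real (card G))\<^sup>2 * (p \<bullet> p)" .
  \<comment> \<open>The fixed part has constant 1, which is covered since \<open>G\<close> contains
    the identity.\<close>
  moreover have "1 * (q \<bullet> q) \<le> (2 * real (card G))\<^sup>2 * (q \<bullet> q)"
  proof (intro mult_right_mono scalar_prod_self_nonneg)
    have "card G \<noteq> 0" using group_one finite_group by auto
    then have "1\<^sup>2 \<le> (2 * real (card G))\<^sup>2" by (intro power_mono) auto
    then show "1 \<le> (2 * real (card G))\<^sup>2" by simp
  qed
  ultimately show "(\<Sum>t\<leftarrow>templates. (t \<bullet> z)\<^sup>2) \<le> (2 * real (card G))\<^sup>2 * (z \<bullet> z)"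
    by (simp add: total zz distrib_left)
qed

text \<open>On chamber representatives the bank is linear, so differences of features are the
  products \<open>t \<bullet> z\<close>. The energy bounds give the constants; \<open>2 / 3\<close>
  is a rational number below \<open>1 / sqrt 2\<close>.\<close>

lemma bilipschitz_templates:
  "bilipschitz_bank d G templates (2 / 3) (2 * real (card G))"
  unfolding bilipschitz_bank_def Let_def
proof (intro ballI)
  fix x y :: "real vec" assume "x \<in> V" "y \<in> V"
  then obtain x' y' where x': "x' \<in> chamber" "orbit_of G x = orbit_of G x'"
    and y': "y' \<in> chamber" "orbit_of G y = orbit_of G y'"
    using orbit_meets_chamber by metis
  define z where "z = x' - y'"
  have V: "x' \<in> V" "y' \<in> V" "z \<in> V" using x' y' chamber_carrier by (auto simp: z_def)
  let ?D = "max_filter_bank G templates (orbit_of G x') - max_filter_bank G templates (orbit_of G y')"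
  let ?S = "\<Sum>t\<leftarrow>templates. (t \<bullet> z)\<^sup>2"
  have coord: "?D $ i = templates ! i \<bullet> z" if "i < length templates" for i
  proof -
    have t: "templates ! i \<in> chamber" using that templates_chamber nth_mem by blast
    then show ?thesis
      using that V x' y' chamber_carrier[OF t]
      by (simp add: max_filter_bank_def max_filter_chamber z_def scalar_prod_bilinear)
  qed
  have "?D \<bullet> ?D = (\<Sum>i = 0..<length templates. ?D $ i * ?D $ i)"
    by (simp add: scalar_prod_def max_filter_bank_def)
  also have "\<dots> = (\<Sum>i = 0..<length templates. (templates ! i \<bullet> z)\<^sup>2)"
    by (intro sum.cong) (auto simp only: coord power2_eq_square atLeastLessThan_iff)
  also have "\<dots> = ?S"
    by (simp add: sum_list_sum_nth)
  finally have D: "vec_norm ?D = sqrt ?S" by (simp add: vec_norm_def)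
  have dist: "orbit_dist (orbit_of G x') (orbit_of G y') = sqrt (z \<bullet> z)"
    using orbit_dist_chamber x' y' by (simp add: vec_norm_def z_def)
  have "(2 / 3) * sqrt (z \<bullet> z) = sqrt ((2 / 3)\<^sup>2 * (z \<bullet> z))"
    by (simp add: real_sqrt_mult)
  also have "\<dots> \<le> sqrt ?S"
    using templates_energy(1)[OF V(3)] scalar_prod_self_nonneg[of z]
    by (intro real_sqrt_le_mono) (simp add: power2_eq_square)
  finally have lower: "(2 / 3) * sqrt (z \<bullet> z) \<le> sqrt ?S" .
  have "sqrt ?S \<le> sqrt ((2 * real (card G))\<^sup>2 * (z \<bullet> z))"
    by (intro real_sqrt_le_mono templates_energy V)
  also have "\<dots> = 2 * real (card G) * sqrt (z \<bullet> z)"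
    by (simp add: real_sqrt_mult)
  finally have "sqrt ?S \<le> 2 * real (card G) * sqrt (z \<bullet> z)" .
  with lower show "2 / 3 * orbit_dist (orbit_of G x) (orbit_of G y)
      \<le> vec_norm (max_filter_bank G templates (orbit_of G x) - max_filter_bank G templates (orbit_of G y)) \<and>
      vec_norm (max_filter_bank G templates (orbit_of G x) - max_filter_bank G templates (orbit_of G y))
      \<le> 2 * real (card G) * orbit_dist (orbit_of G x) (orbit_of G y)"
    by (simp only: x'(2) y'(2) D dist)
qed

lemma max_filter_cond_le: "max_filter_cond d G \<le> ereal (3 * real (card G))"
  unfolding max_filter_cond_def
proof (rule Inf_lower, intro CollectI exI conjI)
  \<comment> \<open>The universal constant 3 is the quotient of 2 by \<open>2 / 3\<close>.\<close>
  show "ereal (3 * real (card G)) = ereal (2 * real (card G) / (2 / 3))" by simp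
  show "set templates \<subseteq> V" using templates_chamber chamber_carrier by blast
  have "card G \<noteq> 0" using group_one finite_group by auto
  then show "0 < 2 * real (card G)" by simp
qed (use bilipschitz_templates in auto)

end

section \<open>Existence of a simple system and the final bound\<close>

lemma (in finite_reflection_group) max_filter_cond_bound:
  "max_filter_cond d G \<le> ereal (3 * real (card G))"
proof -
  let ?R = "unit_roots G"
  have fin: "finite ?R" by (rule finite_unit_roots[OF finite_group])
  obtain \<rho> where \<rho>: "\<rho> \<in> V" "\<forall>a\<in>?R. \<rho> \<bullet> a \<noteq> 0"
    using exists_generic[OF fin] unit_rootsD by auto
  have "finite {a \<in> ?R. 0 < \<rho> \<bullet> a}" "{a \<in> ?R. 0 < \<rho> \<bullet> a} \<subseteq> V"
    using fin unit_rootsD by auto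
  from exists_minimal_generators[OF this]
  obtain D where D: "D \<subseteq> {a \<in> ?R. 0 < \<rho> \<bullet> a}"
    "\<And>a. a \<in> {a \<in> ?R. 0 < \<rho> \<bullet> a} \<Longrightarrow> \<exists>c. (\<forall>b\<in>D. 0 \<le> c b) \<and> a = comb D c"
    "\<forall>b\<in>D. \<nexists>c. (\<forall>e\<in>D - {b}. 0 \<le> c e) \<and> b = comb (D - {b}) c"
    by auto
  interpret reflection_group_chamber d ?R D \<rho> G
  proof unfold_locales
    show "?R \<subseteq> V" using unit_rootsD by auto
    show "a \<bullet> a = 1" if "a \<in> ?R" for a using that unit_rootsD by auto
    show "b \<noteq> comb (D - {b}) c" if "b \<in> D" "\<forall>e\<in>D - {b}. 0 \<le> c e" for b c
      using D(3) that by blast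
  qed (use fin \<rho> D unit_roots_closed in auto)
  show ?thesis by (rule max_filter_cond_le)
qed

theorem mainTheorem3:
  shows "\<exists>C::real. C > 0 \<and>
    (\<forall>(d::nat) (m::nat) (G::real mat set).
       finite G \<and> card G = m \<and> reflection_group d G \<longrightarrow>
       max_filter_cond d G \<le> ereal (C * real m))"
proof (intro exI[of _ 3] conjI allI impI)
  fix d m :: nat and G :: "real mat set"
  assume G: "finite G \<and> card G = m \<and> reflection_group d G"
  then interpret finite_reflection_group d G
    by unfold_locales auto
  show "max_filter_cond d G \<le> ereal (3 * real m)"
    using max_filter_cond_bound G by simp
qed simp

end
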